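(* Let $m\in\mathbb N$, let $\mu$ be a weight on $\mathbb R^n$, let $K:\mathcal D\to[0,\infty)$ be a map and let $\mathcal S\subset\mathcal D$ be a sparse family. Let $\vec P=(p_1,\ldots,p_m)$ with $p_1,\ldots,p_m\in(1,\infty)$, $1/p=1/p_1+\cdots+1/p_m$, and $1<p\le p_0<\infty$. For nonnegative locally integrable $f_1,\ldots,f_m$ on $\mathbb R^n$ define \[\mathfrak I_K^{\mathcal S}(\vec f)=\sum_{S\in\mathcal S}K(S)\prod_{i=1}^m\int_S f_i\,dx\,\mathbf 1_S.\] Suppose there is a constant $C_D$ such that for every $Q\in\mathcal D$, \[\sum_{Q'\in\mathcal D:\,Q'\supsetneq Q}K(Q')|Q'|^{m-1/p_0}\le C_D\,K(Q)|Q|^{m-1/p_0}.\] Then there is a constant $C>0$ independent of $\vec f$ such that \[\|\mathfrak I_K^{\mathcal S}(\vec f)\|_{\mathcal M_\mu^{p,p_0}(\mathbb R^n)}\le C\,A_0\,\|\vec f\|_{\mathcal M^{\vec P,p_0}((\mathbb R^n)^m)}\] provided one of the following holds: (a) $\mu\in A_\infty$ and $A_0:=\sup_{Q\in\mathcal D}K(Q)|Q|^m\left(\frac{\mu(Q)}{|Q|}\right)^{1/p}<\infty$; (b) for some $r>1$, $A_0:=\sup_{Q\in\mathcal D}K(Q)|Q|^m\left(\frac{\mu^r(Q)}{|Q|}\right)^{\frac1{rp}}<\infty$.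
   Context: $\mathcal D=\{2^{-k}(j+[0,1)^n):k\in\mathbb Z,\ j\in\mathbb Z^n\}$ is the standard dyadic grid; $\mathcal Q$ denotes all axis-parallel cubes in $\mathbb R^n$, $|Q|$ the volume. A family $\mathcal S\subset\mathcal D$ is sparse if for each $S\in\mathcal S$ there is a measurable $E_{\mathcal S}(S)\subset S$ with $2|E_{\mathcal S}(S)|\ge|S|$ and the sets $E_{\mathcal S}(S)$, $S\in\mathcal S$, are pairwise disjoint. A weight is a nonnegative locally integrable function, $\mu(Q)=\int_Q\mu$, $\mu^r(Q)=\int_Q\mu^r$. For $1<s<\infty$, $[w]_{A_s}=\sup_{Q\in\mathcal Q}\left(\frac1{|Q|}\int_Q w\right)\left(\frac1{|Q|}\int_Q w^{-1/(s-1)}\right)^{s-1}$, and $w\in A_\infty$ means $\lim_{s\to\infty}[w]_{A_s}<\infty$. Product Morrey norm: $\|\vec f\|_{\mathcal M^{\vec P,p_0}((\mathbb R^n)^m)}=\sup_{Q\in\mathcal Q}|Q|^{1/p_0}\prod_{i=1}^m\left(\frac1{|Q|}\int_Q|f_i|^{p_i}\right)^{1/p_i}$. Radon–Morrey norm: $\|f\|_{\mathcal M_\mu^{p,p_0}(\mathbb R^n)}=\sup_{Q\in\mathcal Q}|Q|^{1/p_0-1/p}\left(\int_Q|f|^p\,d\mu\right)^{1/p}$. *)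

theory Defs
  imports "HOL-Analysis.Analysis"
begin

definition dyadic_cube :: "int \<Rightarrow> int^'n \<Rightarrow> (real^'n::finite) set" where
  "dyadic_cube k j = {x. \<forall>i. 2 powr (- of_int k) * of_int (j$i) \<le> x$i \<and>
                             x$i < 2 powr (- of_int k) * (of_int (j$i) + 1)}"

definition dyadic_grid :: "(real^'n::finite) set set" where
  "dyadic_grid = {dyadic_cube k j | k j. True}"

definition cubes :: "(real^'n::finite) set set" where
  "cubes = {cbox a (a + l *\<^sub>R One) | a l. 0 < l}"

definition sparse :: "(real^'n::finite) set set \<Rightarrow> bool" where
  "sparse \<S> \<longleftrightarrow> \<S> \<subseteq> dyadic_grid \<and>
     (\<exists>E. (\<forall>S\<in>\<S>. E S \<subseteq> S \<and> E S \<in> sets lebesgue \<and>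
               measure lebesgue S \<le> 2 * measure lebesgue (E S)) \<and> disjoint_family_on E \<S>)"

definition locally_integrable :: "(real^'n::finite \<Rightarrow> real) \<Rightarrow> bool" where
  "locally_integrable f \<longleftrightarrow> f \<in> borel_measurable lebesgue \<and>
     (\<forall>C. compact C \<longrightarrow> set_integrable lebesgue C f)"

definition weight :: "(real^'n::finite \<Rightarrow> real) \<Rightarrow> bool" where
  "weight w \<longleftrightarrow> (\<forall>x. 0 \<le> w x) \<and> locally_integrable w"

text \<open>Real powers on [0,\<infinity>] (used with positive exponents): \<infinity>^a = \<infinity>.\<close>
definition ennpowr :: "ennreal \<Rightarrow> real \<Rightarrow> ennreal" where
  "ennpowr x a = (if x = \<infinity> then \<infinity> else ennreal (enn2real x powr a))"

definition A_const :: "real \<Rightarrow> (real^'n::finite \<Rightarrow> real) \<Rightarrow> ennreal" where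
  "A_const s w = (SUP Q\<in>cubes.
      ((\<integral>\<^sup>+x\<in>Q. ennreal (w x) \<partial>lebesgue) / ennreal (measure lebesgue Q)) *
      ennpowr ((\<integral>\<^sup>+x\<in>Q. (if w x = 0 then \<infinity> else ennreal (w x powr (-1/(s-1)))) \<partial>lebesgue)
                / ennreal (measure lebesgue Q)) (s - 1))"

definition A_infty :: "(real^'n::finite \<Rightarrow> real) \<Rightarrow> bool" where
  "A_infty w \<longleftrightarrow> (\<exists>L. ((\<lambda>s. A_const s w) \<longlongrightarrow> L) at_top \<and> L < \<infinity>)"

definition sparse_op :: "((real^'n::finite) set \<Rightarrow> real) \<Rightarrow> (real^'n) set set \<Rightarrow> nat \<Rightarrow>
    (nat \<Rightarrow> real^'n \<Rightarrow> real) \<Rightarrow> real^'n \<Rightarrow> ennreal" where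
  "sparse_op K \<S> m f x = (\<Sum>\<^sub>\<infinity>S\<in>\<S>. ennreal (K S) *
       (\<Prod>i<m. \<integral>\<^sup>+y\<in>S. ennreal (f i y) \<partial>lebesgue) * indicator S x)"

definition radon_morrey_norm :: "(real^'n::finite \<Rightarrow> real) \<Rightarrow> real \<Rightarrow> real \<Rightarrow>
    (real^'n \<Rightarrow> ennreal) \<Rightarrow> ennreal" where
  "radon_morrey_norm \<mu> p p0 g = (SUP Q\<in>cubes.
      ennreal (measure lebesgue Q powr (1/p0 - 1/p)) *
      ennpowr (\<integral>\<^sup>+x\<in>Q. ennpowr (g x) p * ennreal (\<mu> x) \<partial>lebesgue) (1/p))"

definition prod_morrey_norm :: "nat \<Rightarrow> (nat \<Rightarrow> real) \<Rightarrow> real \<Rightarrow>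
    (nat \<Rightarrow> real^'n::finite \<Rightarrow> real) \<Rightarrow> ennreal" where
  "prod_morrey_norm m P p0 f = (SUP Q\<in>cubes.
      ennreal (measure lebesgue Q powr (1/p0)) *
      (\<Prod>i<m. ennpowr ((\<integral>\<^sup>+x\<in>Q. ennreal (\<bar>f i x\<bar> powr P i) \<partial>lebesgue)
                          / ennreal (measure lebesgue Q)) (1 / P i)))"

end

(* On a dyadic cube Q split the sparse operator into the cubes inside Q and those strictly containing Q.
   The latter give a constant on Q: Jensen's inequality bounds each term by K(Q') |Q'|^(m-1/p0) times
   the Morrey norm, and the summation condition leaves only the term of Q. For the former, restricted
   to finitely many cubes with sum J, one has int J^p dmu = sum_S c_S int_S J^(p-1) dmu. The testing
   condition bounds each term by b_S T_S^(1-1/p), where b_S^p = A0^p |S| prod_i (avg_S f_i)^p and T_S is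
   a Carleson term of J^(p-1): with respect to mu if mu is in A_infinity (sparseness passes from
   Lebesgue measure to mu), and with respect to Lebesgue measure, after Hoelder's inequality, in the
   power bump case. By the Carleson embedding theorem the sum of the T_S is absorbed into int J^p dmu,
   which is finite, and the sum of the b_S^p is at most a constant times A0^p prod_i |f_i|_{p_i}^p.
   A general cube is covered by 2^n dyadic cubes of comparable size. *)
theory Submission
  imports Defs
begin

section \<open>Powers and integrals of extended nonnegative functions\<close>

text \<open>Expanding a single factor of J^p makes J^(p-1) play the part of the dual function: the
  power p/(p-1) of it is J^p, so its norm in L^(p/(p-1))(mu) is governed by the very quantity to be
  bounded. The shape b * T^(1-1/p) is what Young's inequality with a small weight can separate: the
  multiple of T sums back to a fraction of the left side, while b^p contains only A0, |S| and the
  averages of the f_i. Subtracting that fraction requires a finite left side. This is the reason for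
  finite subfamilies; all bounds are uniform in the subfamily, so monotone convergence restores the
  full sum. The Carleson embedding is proved for an arbitrary measure and a finite nested family, so
  that one statement serves both mu and Lebesgue measure. In the power bump case r > 1 pushes the
  Hoelder exponent on the side of J strictly below p/(p-1), and the gap leaves an exponent above 1
  for the embedding. Work in [0,\<infinity>] is forced because the local norms of the f_i and the
  local integrals of mu^r may be infinite.\<close>

lemma ennpowr_ennreal [simp]: "0 \<le> x \<Longrightarrow> ennpowr (ennreal x) a = ennreal (x powr a)"
  by (simp add: ennpowr_def)

lemma ennpowr_top [simp]: "ennpowr top a = top"
  by (simp add: ennpowr_def)

lemma ennpowr_0 [simp]: "ennpowr 0 a = 0"
  by (simp add: ennpowr_def)

lemma ennpowr_eq_0_iff [simp]: "ennpowr x a = 0 \<longleftrightarrow> x = 0"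
  by (cases x) auto

lemma ennpowr_eq_top_iff [simp]: "ennpowr x a = top \<longleftrightarrow> x = top"
  by (cases x) auto

lemma ennpowr_mono: "x \<le> y \<Longrightarrow> 0 \<le> a \<Longrightarrow> ennpowr x a \<le> ennpowr y a"
  by (cases x; cases y) (auto intro!: ennreal_leI powr_mono2 simp: top_unique)

text \<open>The conventions 0^a = 0 and \<infinity>^a = \<infinity> agree with 0 * \<infinity> = 0,
  so multiplicativity holds for every real exponent and no case distinction is needed later.\<close>

lemma ennpowr_mult: "ennpowr (x * y) a = ennpowr x a * ennpowr y a"
  by (cases x; cases y)
    (auto simp: ennreal_mult_top ennreal_top_mult powr_mult simp flip: ennreal_mult)

lemma ennpowr_ennpowr: "ennpowr (ennpowr x a) b = ennpowr x (a * b)"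
  by (cases x) (auto simp: powr_powr)

lemma ennpowr_1 [simp]: "ennpowr x 1 = x"
  by (cases x) auto

lemma ennpowr_prod: "ennpowr (\<Prod>i\<in>I. f i) a = (\<Prod>i\<in>I. ennpowr (f i) a)"
proof (induction I rule: infinite_finite_induct)
  case (insert i I)
  then show ?case by (simp add: ennpowr_mult)
qed (auto simp flip: ennreal_1)

text \<open>The crude bound x + y \<le> 2 max(x, y) followed by monotonicity of the power; it costs
  only the factor 2^a.\<close>

lemma ennpowr_add_le:
  assumes "0 \<le> a"
  shows "ennpowr (x + y) a \<le> ennreal (2 powr a) * (ennpowr x a + ennpowr y a)"
proof -
  have "x + y \<le> ennreal 2 * max x y"
    by (simp add: mult_2 add_mono)
  then have "ennpowr (x + y) a \<le> ennreal (2 powr a) * ennpowr (max x y) a"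
    using ennpowr_mono[OF _ assms] by (metis ennpowr_mult ennpowr_ennreal zero_le_numeral)
  also have "ennpowr (max x y) a \<le> ennpowr x a + ennpowr y a"
    by (simp add: max_def)
  finally show ?thesis by (simp add: mult_left_mono)
qed

text \<open>For a > 0 the power is an order isomorphism of [0,\<infinity>] with inverse the power
  1/a, so it commutes with all suprema. This lets monotone convergence be applied to p-th powers of
  partial sums.\<close>

lemma ennpowr_SUP:
  assumes "0 < a"
  shows "ennpowr (SUP i\<in>I. f i) a = (SUP i\<in>I. ennpowr (f i) a)"
proof (rule antisym)
  let ?L = "SUP i\<in>I. ennpowr (f i) a"
  have "(SUP i\<in>I. f i) \<le> ennpowr ?L (1 / a)"
  proof (rule SUP_least)
    fix i assume "i \<in> I"
    then have "ennpowr (ennpowr (f i) a) (1 / a) \<le> ennpowr ?L (1 / a)"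
      using assms by (intro ennpowr_mono SUP_upper) auto
    then show "f i \<le> ennpowr ?L (1 / a)"
      using assms by (simp add: ennpowr_ennpowr)
  qed
  then have "ennpowr (SUP i\<in>I. f i) a \<le> ennpowr (ennpowr ?L (1 / a)) a"
    using assms by (intro ennpowr_mono) auto
  then show "ennpowr (SUP i\<in>I. f i) a \<le> ?L"
    using assms by (simp add: ennpowr_ennpowr)
qed (use assms in \<open>auto intro!: SUP_least ennpowr_mono SUP_upper\<close>)

lemma measurable_ennpowr [measurable (raw)]:
  assumes [measurable]: "f \<in> borel_measurable M"
  shows "(\<lambda>x. ennpowr (f x) a) \<in> borel_measurable M"
  unfolding ennpowr_def by measurable

section \<open>Young's and Hoelder's inequalities for functions with values in
  [0,\<infinity>]\<close>

lemma ennreal_le_ennpowr_add: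
  assumes "u > 1" "v > 1" "1 / u + 1 / v = 1"
  shows "a * b \<le> ennpowr a u * ennreal (1 / u) + ennpowr b v * ennreal (1 / v)"
proof (cases "a = top \<or> b = top")
  case True
  then show ?thesis using assms by (auto simp: ennreal_top_mult)
next
  case False
  then obtain x y where "a = ennreal x" "b = ennreal y" "x \<ge> 0" "y \<ge> 0"
    by (metis ennreal_cases)
  then show ?thesis
    using Youngs_inequality[of u v x y] assms
    by (simp flip: ennreal_mult ennreal_plus)
qed

lemma Holder_nn_integral:
  assumes uv: "u > 1" "v > 1" "1 / u + 1 / v = 1"
    and [measurable]: "f \<in> borel_measurable M" "g \<in> borel_measurable M"
  shows "(\<integral>\<^sup>+x. f x * g x \<partial>M) \<le>
    ennpowr (\<integral>\<^sup>+x. ennpowr (f x) u \<partial>M) (1 / u) * ennpowr (\<integral>\<^sup>+x. ennpowr (g x) v \<partial>M) (1 / v)"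
proof -
  define X where "X = (\<integral>\<^sup>+x. ennpowr (f x) u \<partial>M)"
  define Y where "Y = (\<integral>\<^sup>+x. ennpowr (g x) v \<partial>M)"
  consider "X = 0" | "Y = 0" | "X \<noteq> 0" "Y \<noteq> 0" "X = top \<or> Y = top"
    | x y where "X = ennreal x" "Y = ennreal y" "x > 0" "y > 0"
    by (metis ennreal_cases ennreal_0 order_less_le)
  then show ?thesis
  proof cases
    case 1
    then have "AE x in M. f x = 0"
      unfolding X_def by (subst (asm) nn_integral_0_iff_AE) auto
    then have "(\<integral>\<^sup>+x. f x * g x \<partial>M) = (\<integral>\<^sup>+x. 0 \<partial>M)"
      by (intro nn_integral_cong_AE) auto
    then show ?thesis by simp
  next
    case 2
    then have "AE x in M. g x = 0"
      unfolding Y_def by (subst (asm) nn_integral_0_iff_AE) auto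
    then have "(\<integral>\<^sup>+x. f x * g x \<partial>M) = (\<integral>\<^sup>+x. 0 \<partial>M)"
      by (intro nn_integral_cong_AE) auto
    then show ?thesis by simp
  next
    case 3
    then have "ennpowr X (1 / u) * ennpowr Y (1 / v) = top"
      by (auto simp: ennreal_mult_top ennreal_top_mult)
    then show ?thesis unfolding X_def Y_def by simp
  next
    case (4 x y)
    \<comment> \<open>Reciprocals of the two norms: after scaling by them both functions have norm
      1, and integrating Young's inequality gives 1 / u + 1 / v = 1.\<close>
    let ?a = "ennreal (x powr (- 1 / u))" and ?b = "ennreal (y powr (- 1 / v))"
    have "?a * ?b * (\<integral>\<^sup>+x. f x * g x \<partial>M) = (\<integral>\<^sup>+x. (?a * f x) * (?b * g x) \<partial>M)"
      by (subst nn_integral_cmult[symmetric]) (auto simp: ac_simps)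
    also have "\<dots> \<le> (\<integral>\<^sup>+x. ennpowr (?a * f x) u * ennreal (1 / u) + ennpowr (?b * g x) v * ennreal (1 / v) \<partial>M)"
      by (intro nn_integral_mono ennreal_le_ennpowr_add uv)
    also have "\<dots> = ennpowr ?a u * X * ennreal (1 / u) + ennpowr ?b v * Y * ennreal (1 / v)"
      unfolding X_def Y_def
      by (simp add: nn_integral_add nn_integral_multc nn_integral_cmult ennpowr_mult)
    also have "\<dots> = ennreal (1 / x) * X * ennreal (1 / u) + ennreal (1 / y) * Y * ennreal (1 / v)"
      using 4 uv by (simp add: powr_powr powr_neg_one)
    also have "\<dots> = 1"
      using 4 uv by (simp flip: ennreal_mult ennreal_plus add: ennreal_mult[symmetric])
    finally have le: "?a * ?b * (\<integral>\<^sup>+x. f x * g x \<partial>M) \<le> 1" .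
    have "(\<integral>\<^sup>+x. f x * g x \<partial>M) = ennreal (x powr (1 / u) * y powr (1 / v)) * (?a * ?b * (\<integral>\<^sup>+x. f x * g x \<partial>M))"
      using 4 by (simp add: powr_minus_divide ennreal_mult[symmetric] mult.assoc[symmetric])
    also have "\<dots> \<le> ennreal (x powr (1 / u) * y powr (1 / v))"
      using mult_left_mono[OF le] by simp
    also have "\<dots> = ennpowr X (1 / u) * ennpowr Y (1 / v)"
      using 4 by (simp add: ennreal_mult)
    finally show ?thesis unfolding X_def Y_def .
  qed
qed

section \<open>Maximal functions over finite laminar families\<close>

text \<open>Convexity of s^(q/(q-1)): its graph lies above the tangent at s = x^(q-1), whose slope
  is q/(q-1) * x; evaluate at s = a^(q-1). Young's inequality is the same fact in product
  form.\<close>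

lemma powr_diff_le:
  fixes a x q :: real
  assumes "q > 1" "0 \<le> a" "0 \<le> x"
  shows "x powr q \<le> a powr q + q / (q - 1) * x * (x powr (q - 1) - a powr (q - 1))"
proof -
  let ?r = "q / (q - 1)"
  have "x * a powr (q - 1) \<le> x powr q / q + (a powr (q - 1)) powr ?r / ?r"
    using assms by (intro Youngs_inequality) (auto simp: field_simps)
  also have "(a powr (q - 1)) powr ?r = a powr q"
    using assms by (simp add: powr_powr)
  finally have "?r * (x * a powr (q - 1)) \<le> ?r * (x powr q / q + a powr q / ?r)"
    using assms by (intro mult_left_mono) auto
  also have "\<dots> = x powr q / (q - 1) + a powr q"
    using assms by (simp add: field_simps)
  finally have *: "?r * (x * a powr (q - 1)) \<le> x powr q / (q - 1) + a powr q" .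
  have "x * x powr (q - 1) = x powr q"
    using assms by (simp add: powr_mult_base)
  then have "?r * x * (x powr (q - 1) - a powr (q - 1)) = ?r * x powr q - ?r * (x * a powr (q - 1))"
    by (simp add: algebra_simps)
  moreover have "?r * x powr q = x powr q + x powr q / (q - 1)"
    using assms by (simp add: field_simps)
  ultimately show ?thesis using * by linarith
qed

definition laminar :: "'a set set \<Rightarrow> bool" where
  "laminar F \<longleftrightarrow> (\<forall>S\<in>F. \<forall>T\<in>F. S \<inter> T = {} \<or> S \<subseteq> T \<or> T \<subseteq> S)"

lemma laminar_subset: "laminar F \<Longrightarrow> G \<subseteq> F \<Longrightarrow> laminar G"
  unfolding laminar_def by blast

text \<open>With averages for \<open>a\<close> this is the dyadic maximal function of a finite
  family. The inserted 0 is its value off the union and keeps \<open>Max\<close> meaningful for the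
  empty family.\<close>

definition max_on :: "'a set set \<Rightarrow> ('a set \<Rightarrow> real) \<Rightarrow> 'a \<Rightarrow> real" where
  "max_on F a x = Max (insert 0 ((\<lambda>S. a S * indicator S x) ` F))"

lemma max_on_empty [simp]: "max_on {} a x = 0"
  by (simp add: max_on_def)

lemma max_on_insert:
  "finite F \<Longrightarrow> max_on (insert S F) a x = max (a S * indicator S x) (max_on F a x)"
  by (simp add: max_on_def insert_commute[of 0])

lemma max_on_nonneg: "finite F \<Longrightarrow> 0 \<le> max_on F a x"
  by (simp add: max_on_def)

lemma max_on_ge: "finite F \<Longrightarrow> S \<in> F \<Longrightarrow> x \<in> S \<Longrightarrow> a S \<le> max_on F a x"
  unfolding max_on_def by (rule Max_ge) (auto intro!: image_eqI[of _ _ S])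

lemma measurable_max_on:
  "finite F \<Longrightarrow> (\<And>S. S \<in> F \<Longrightarrow> S \<in> sets M) \<Longrightarrow> max_on F a \<in> borel_measurable M"
proof (induction F rule: finite_induct)
  case empty
  then show ?case by (simp add: max_on_def[abs_def])
next
  case (insert S F)
  have [measurable]: "S \<in> sets M" "max_on F a \<in> borel_measurable M"
    using insert by auto
  have "(\<lambda>x. max (a S * indicator S x) (max_on F a x)) \<in> borel_measurable M"
    by measurable
  then show ?case
    using insert by (simp add: max_on_insert cong: measurable_cong)
qed

text \<open>Adding a minimal set \<open>S\<close> to \<open>F\<close> changes the maximal function only on \<open>S\<close>, where it was
  constant; this replaces the distribution function argument for Doob's inequality.\<close>

lemma Doob_weak:
  fixes g :: "'a \<Rightarrow> ennreal"
  assumes "finite F" "laminar F" and q: "q > 1"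
    and "\<And>S. S \<in> F \<Longrightarrow> S \<in> sets M"
    and [measurable]: "g \<in> borel_measurable M"
    and "\<And>S. S \<in> F \<Longrightarrow> 0 \<le> a S"
    and "\<And>S. S \<in> F \<Longrightarrow> ennreal (a S) * emeasure M S \<le> (\<integral>\<^sup>+x\<in>S. g x \<partial>M)"
  shows "(\<integral>\<^sup>+x. ennreal (max_on F a x powr q) \<partial>M)
    \<le> ennreal (q / (q - 1)) * (\<integral>\<^sup>+x. g x * ennreal (max_on F a x powr (q - 1)) \<partial>M)"
  using assms(1,2,4,6,7)
proof (induction F rule: finite_psubset_induct)
  case (psubset F)
  let ?r = "q / (q - 1)"
  show ?case
  proof (cases "F = {}")
    case False
    obtain S where S: "S \<in> F" "\<And>T. T \<in> F \<Longrightarrow> T \<subseteq> S \<Longrightarrow> T = S"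
      using finite_has_minimal[OF psubset.hyps False] by metis
    define G where "G = F - {S}"
    have G: "G \<subset> F" "finite G" "F = insert S G"
      using S psubset.hyps by (auto simp: G_def)
    have Sm [measurable]: "S \<in> sets M" and aS: "0 \<le> a S"
      using psubset.prems S by auto
    have [measurable]: "max_on G a \<in> borel_measurable M"
      using psubset.prems G by (intro measurable_max_on) auto
    have IH: "(\<integral>\<^sup>+x. ennreal (max_on G a x powr q) \<partial>M)
        \<le> ennreal ?r * (\<integral>\<^sup>+x. g x * ennreal (max_on G a x powr (q - 1)) \<partial>M)"
    proof (rule psubset.IH[OF G(1)])
      have "T \<in> F" if "T \<in> G" for T
        using that G(1) by auto
      then show "\<And>T. T \<in> G \<Longrightarrow> T \<in> sets M" "\<And>T. T \<in> G \<Longrightarrow> 0 \<le> a T"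
        "\<And>T. T \<in> G \<Longrightarrow> ennreal (a T) * emeasure M T \<le> (\<integral>\<^sup>+x\<in>T. g x \<partial>M)"
        using psubset.prems by simp_all
      show "laminar G"
        using laminar_subset[OF psubset.prems(1)] G(1) by blast
    qed
    \<comment> \<open>A member of \<open>G\<close> that meets the minimal set \<open>S\<close> must
      contain it, so no indicator in the maximum varies on \<open>S\<close>.\<close>
    have const: "max_on G a x = max_on G a y" if "x \<in> S" "y \<in> S" for x y
    proof -
      have "indicator T x = (indicator T y :: real)" if "T \<in> G" for T
      proof -
        have T: "T \<in> F" "T \<noteq> S"
          using that by (auto simp: G_def)
        then have "S \<inter> T = {} \<or> S \<subseteq> T \<or> T \<subseteq> S"
          using \<open>laminar F\<close> S(1) unfolding laminar_def by simp
        then have "S \<inter> T = {} \<or> S \<subseteq> T"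
          using S(2) T by auto
        then show ?thesis using \<open>x \<in> S\<close> \<open>y \<in> S\<close> by (auto simp: indicator_def)
      qed
      then have "(\<lambda>T. a T * indicator T x) ` G = (\<lambda>T. a T * indicator T y) ` G"
        by (intro image_cong) simp_all
      then show ?thesis unfolding max_on_def by simp
    qed
    obtain b where b: "0 \<le> b" "\<And>x. x \<in> S \<Longrightarrow> max_on G a x = b"
    proof (cases "S = {}")
      case True
      then show ?thesis using that[of 0] by simp
    next
      case False
      then obtain y where "y \<in> S" by auto
      then show ?thesis
        by (intro that[of "max_on G a y"] max_on_nonneg[OF G(2)] const)
    qed
    define d where "d = max (a S) b powr (q - 1) - b powr (q - 1)"
    have d: "0 \<le> d"
      using b q by (simp add: d_def powr_mono2)
    have eq: "max_on F a x = (if x \<in> S then max (a S) b else max_on G a x)" for x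
      using max_on_nonneg[OF G(2), of a x] b(2)[of x]
      by (simp add: G(3) max_on_insert[OF G(2)] max_absorb2)
    have le: "max (a S) b powr q \<le> b powr q + ?r * a S * d"
    proof (cases "a S \<le> b")
      case True
      then show ?thesis by (simp add: d_def max_absorb2)
    next
      case False
      then have "max (a S) b = a S" by simp
      with powr_diff_le[OF q b(1) aS] show ?thesis unfolding d_def by metis
    qed
    \<comment> \<open>The two increments match: adding \<open>S\<close> raises the left side by at
      most \<open>?r * a S * d\<close> times the measure of \<open>S\<close>, and the right side by
      \<open>?r * d\<close> times the integral of \<open>g\<close> over \<open>S\<close>. The
      hypothesis on \<open>a S\<close> compares exactly these.\<close>
    have 1: "max_on F a x powr q \<le> max_on G a x powr q + ?r * a S * d * indicator S x" for x
      using le b(2)[of x] by (cases "x \<in> S") (simp_all add: eq)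
    have 2: "max_on F a x powr (q - 1) = max_on G a x powr (q - 1) + d * indicator S x" for x
      using b(2)[of x] by (cases "x \<in> S") (simp_all add: eq d_def)
    have "(\<integral>\<^sup>+x. ennreal (max_on F a x powr q) \<partial>M)
        \<le> (\<integral>\<^sup>+x. ennreal (max_on G a x powr q) + ennreal (?r * a S * d) * indicator S x \<partial>M)"
    proof (rule nn_integral_mono)
      fix x
      show "ennreal (max_on F a x powr q)
          \<le> ennreal (max_on G a x powr q) + ennreal (?r * a S * d) * indicator S x"
        using ennreal_leI[OF 1[of x]] q aS d by (cases "x \<in> S") (simp_all flip: ennreal_plus)
    qed
    also have "\<dots> = (\<integral>\<^sup>+x. ennreal (max_on G a x powr q) \<partial>M)
        + ennreal ?r * ennreal d * (ennreal (a S) * emeasure M S)"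
    proof -
      have "0 \<le> ?r" using q by simp
      then have "ennreal (?r * a S * d) = ennreal ?r * ennreal d * ennreal (a S)"
        using aS d by (simp only: ennreal_mult mult_nonneg_nonneg ac_simps)
      then have "ennreal (?r * a S * d) * emeasure M S
          = ennreal ?r * ennreal d * (ennreal (a S) * emeasure M S)"
        by (simp only: mult.assoc)
      moreover have "(\<integral>\<^sup>+x. ennreal (?r * a S * d) * indicator S x \<partial>M)
          = ennreal (?r * a S * d) * emeasure M S"
        using Sm by (rule nn_integral_cmult_indicator)
      ultimately show ?thesis
        by (subst nn_integral_add) simp_all
    qed
    also have "\<dots> \<le> ennreal ?r * (\<integral>\<^sup>+x. g x * ennreal (max_on G a x powr (q - 1)) \<partial>M)
        + ennreal ?r * ennreal d * (\<integral>\<^sup>+x\<in>S. g x \<partial>M)"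
      using psubset.prems S by (intro add_mono IH mult_left_mono) auto
    also have "\<dots> = ennreal ?r * (\<integral>\<^sup>+x. g x * ennreal (max_on G a x powr (q - 1))
        + ennreal d * (g x * indicator S x) \<partial>M)"
      by (subst nn_integral_add) (auto simp: nn_integral_cmult distrib_left mult.assoc)
    also have "(\<lambda>x. g x * ennreal (max_on G a x powr (q - 1)) + ennreal d * (g x * indicator S x))
        = (\<lambda>x. g x * ennreal (max_on F a x powr (q - 1)))"
      using d by (auto simp: 2 fun_eq_iff indicator_def distrib_left ac_simps)
    finally show ?thesis .
  qed (use q in simp)
qed

text \<open>With r = q/(q-1), the product r * g * m^(q-1) is at most m^q / 2 where 2 * r * g \<le>
  m, and at most (2r)^q * g^q / 2 elsewhere. The first part is subtracted from the left side of
  \<open>Doob_weak\<close>; doubling the remainder yields the constant.\<close>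

lemma Doob_strong:
  fixes g :: "'a \<Rightarrow> real"
  assumes F: "finite F" "laminar F" and q: "q > 1"
    and S: "\<And>S. S \<in> F \<Longrightarrow> S \<in> sets M" "\<And>S. S \<in> F \<Longrightarrow> emeasure M S < \<infinity>"
    and g [measurable]: "g \<in> borel_measurable M" and g0: "\<And>x. 0 \<le> g x"
    and a: "\<And>S. S \<in> F \<Longrightarrow> 0 \<le> a S"
      "\<And>S. S \<in> F \<Longrightarrow> ennreal (a S) * emeasure M S \<le> (\<integral>\<^sup>+x\<in>S. ennreal (g x) \<partial>M)"
  shows "(\<integral>\<^sup>+x. ennreal (max_on F a x powr q) \<partial>M)
    \<le> ennreal ((2 * q / (q - 1)) powr q) * (\<integral>\<^sup>+x. ennreal (g x powr q) \<partial>M)"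
proof -
  let ?m = "max_on F a" and ?r = "q / (q - 1)" and ?c = "(2 * q / (q - 1)) powr q"
  let ?I = "\<integral>\<^sup>+x. ennreal (?m x powr q) \<partial>M" and ?G = "\<integral>\<^sup>+x. ennreal (g x powr q) \<partial>M"
  have [measurable]: "?m \<in> borel_measurable M"
    using F S by (intro measurable_max_on)
  have m0: "0 \<le> ?m x" for x
    using F(1) by (rule max_on_nonneg)
  have r: "0 < ?r" using q by simp
  have pt: "?r * (g x * ?m x powr (q - 1)) \<le> 1/2 * ?m x powr q + ?c / 2 * g x powr q" for x
  proof (cases "2 * ?r * g x \<le> ?m x")
    case True
    have "?r * (g x * ?m x powr (q - 1)) = (?r * g x) * ?m x powr (q - 1)"
      by simp
    also have "\<dots> \<le> (?m x / 2) * ?m x powr (q - 1)"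
      using True by (intro mult_right_mono) (auto simp: ac_simps)
    also have "\<dots> = 1/2 * ?m x powr q"
      using powr_mult_base[OF m0, of x "q - 1"] by simp
    finally show ?thesis by (rule add_increasing2[rotated]) simp
  next
    case False
    have y0: "0 \<le> 2 * ?r * g x" using r g0[of x] by (intro mult_nonneg_nonneg) auto
    have "?r * (g x * ?m x powr (q - 1)) = (?r * g x) * ?m x powr (q - 1)"
      by simp
    also have "\<dots> \<le> (?r * g x) * (2 * ?r * g x) powr (q - 1)"
      using False r g0[of x] m0[of x] q by (intro mult_left_mono powr_mono2) auto
    also have "\<dots> = 1 / 2 * (2 * ?r * g x) powr q"
      using powr_mult_base[OF y0, of "q - 1"] by (simp add: ac_simps)
    also have "\<dots> = ?c / 2 * g x powr q"
      using r g0[of x] powr_mult[of "2 * ?r" "g x" q] by simp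
    finally show ?thesis by (rule add_increasing[rotated]) simp
  qed
  \<comment> \<open>Finiteness of the left side, which the later subtraction requires: at each point
    the maximum is 0 or one of finitely many values \<open>a S\<close>, each living on a set of
    finite measure.\<close>
  have "?I \<le> (\<integral>\<^sup>+x. (\<Sum>S\<in>F. ennreal (a S powr q) * indicator S x) \<partial>M)"
  proof (rule nn_integral_mono)
    fix x
    have "?m x \<in> insert 0 ((\<lambda>S. a S * indicator S x) ` F)"
      unfolding max_on_def using F by (intro Max_in) auto
    then consider "?m x = 0" | S where "S \<in> F" "x \<in> S" "?m x = a S"
      by (cases "?m x = 0") (auto simp: indicator_def split: if_splits)
    then show "ennreal (?m x powr q) \<le> (\<Sum>S\<in>F. ennreal (a S powr q) * indicator S x)"
    proof cases
      case (2 S)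
      then show ?thesis
        using member_le_sum[of S F "\<lambda>S. ennreal (a S powr q) * indicator S x"] F by auto
    qed simp
  qed
  also have "\<dots> = (\<Sum>S\<in>F. \<integral>\<^sup>+x. ennreal (a S powr q) * indicator S x \<partial>M)"
    using S(1) by (intro nn_integral_sum) auto
  also have "\<dots> = (\<Sum>S\<in>F. ennreal (a S powr q) * emeasure M S)"
    using S(1) by (intro sum.cong) (auto simp: nn_integral_cmult_indicator)
  also have "\<dots> < \<infinity>"
    using S F by (auto simp: ennreal_mult_less_top)
  finally have fin: "?I < \<infinity>" .
  have "?I \<le> ennreal ?r * (\<integral>\<^sup>+x. ennreal (g x) * ennreal (?m x powr (q - 1)) \<partial>M)"
    using assms by (intro Doob_weak) auto
  also have "\<dots> = (\<integral>\<^sup>+x. ennreal (?r * (g x * ?m x powr (q - 1))) \<partial>M)"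
    using r g0 by (subst nn_integral_cmult[symmetric]) (auto simp flip: ennreal_mult)
  also have "\<dots> \<le> (\<integral>\<^sup>+x. ennreal (1/2) * ennreal (?m x powr q) + ennreal (?c / 2) * ennreal (g x powr q) \<partial>M)"
  proof (rule nn_integral_mono)
    fix x
    show "ennreal (?r * (g x * ?m x powr (q - 1)))
        \<le> ennreal (1/2) * ennreal (?m x powr q) + ennreal (?c / 2) * ennreal (g x powr q)"
      using ennreal_leI[OF pt[of x]] by (simp only: ennreal_plus ennreal_mult powr_ge_zero
        mult_nonneg_nonneg zero_le_divide_iff zero_le_numeral zero_le_one simp_thms)
  qed
  also have "\<dots> = ennreal (1/2) * ?I + ennreal (?c / 2) * ?G"
    by (subst nn_integral_add) (auto simp: nn_integral_cmult)
  finally have le: "?I \<le> ennreal (1/2) * ?I + ennreal (?c / 2) * ?G" .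
  show ?thesis
  proof (cases "?G = \<infinity>")
    case True
    then show ?thesis using q by (simp add: ennreal_mult_top)
  next
    case False
    then obtain G where G: "?G = ennreal G" "0 \<le> G" by (cases ?G) auto
    obtain I where I: "?I = ennreal I" "0 \<le> I" using fin by (cases ?I) auto
    have "ennreal I \<le> ennreal (1/2 * I + ?c / 2 * G)"
      using le unfolding G I using G(2) I(2) by (simp only: ennreal_plus ennreal_mult powr_ge_zero
        mult_nonneg_nonneg zero_le_divide_iff zero_le_numeral zero_le_one simp_thms)
    then have "I \<le> 1/2 * I + ?c / 2 * G"
      using G(2) I(2) by (subst (asm) ennreal_le_iff) auto
    then show ?thesis unfolding G I using G(2) by (simp flip: ennreal_mult)
  qed
qed

section \<open>Averages and the Carleson embedding\<close>

definition avg :: "'a measure \<Rightarrow> ('a \<Rightarrow> real) \<Rightarrow> 'a set \<Rightarrow> real" where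
  "avg M g S = enn2real (\<integral>\<^sup>+x\<in>S. ennreal (g x) \<partial>M) / measure M S"

lemma avg_nonneg [simp]: "0 \<le> avg M g S"
  by (simp add: avg_def)

text \<open>Only an inequality, because \<open>enn2real\<close> turns an infinite integral into 0;
  this direction is the hypothesis of the maximal inequality.\<close>

lemma avg_mult_le:
  assumes "emeasure M S < \<infinity>"
  shows "ennreal (avg M g S) * emeasure M S \<le> (\<integral>\<^sup>+x\<in>S. ennreal (g x) \<partial>M)"
proof (cases "measure M S = 0")
  case False
  have "ennreal (avg M g S) * emeasure M S = ennreal (avg M g S * measure M S)"
    using assms by (simp add: emeasure_eq_ennreal_measure ennreal_mult)
  also have "\<dots> = ennreal (enn2real (\<integral>\<^sup>+x\<in>S. ennreal (g x) \<partial>M))"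
    using False by (simp add: avg_def)
  also have "\<dots> \<le> (\<integral>\<^sup>+x\<in>S. ennreal (g x) \<partial>M)"
    by (simp add: ennreal_enn2real_if)
  finally show ?thesis .
qed (use assms in \<open>simp add: avg_def\<close>)

text \<open>If the integral over \<open>S\<close> is infinite then \<^term>\<open>avg M g S\<close> is \<open>0\<close>; the estimate below is still
  true in that case.\<close>

lemma Carleson_embedding:
  fixes g :: "'a \<Rightarrow> real" and c :: real
  assumes F: "finite F" "laminar F" and q: "q > 1"
    and S: "\<And>S. S \<in> F \<Longrightarrow> S \<in> sets M" "\<And>S. S \<in> F \<Longrightarrow> emeasure M S < \<infinity>"
    and g [measurable]: "g \<in> borel_measurable M" and g0: "\<And>x. 0 \<le> g x"
    and E: "\<And>S. S \<in> F \<Longrightarrow> E S \<in> sets M" "\<And>S. S \<in> F \<Longrightarrow> E S \<subseteq> S" "disjoint_family_on E F"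
      "\<And>S. S \<in> F \<Longrightarrow> emeasure M S \<le> ennreal c * emeasure M (E S)"
  shows "(\<Sum>S\<in>F. ennreal (avg M g S powr q) * emeasure M S)
    \<le> ennreal c * ennreal ((2 * q / (q - 1)) powr q) * (\<integral>\<^sup>+x. ennreal (g x powr q) \<partial>M)"
proof -
  let ?a = "avg M g"
  have "(\<Sum>S\<in>F. ennreal (?a S powr q) * emeasure M S)
      \<le> (\<Sum>S\<in>F. ennreal (?a S powr q) * (ennreal c * emeasure M (E S)))"
    by (intro sum_mono mult_left_mono E) auto
  also have "\<dots> = ennreal c * (\<Sum>S\<in>F. \<integral>\<^sup>+x. ennreal (?a S powr q) * indicator (E S) x \<partial>M)"
    using E(1) by (simp add: nn_integral_cmult_indicator sum_distrib_left mult.left_commute cong: sum.cong)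
  also have "(\<Sum>S\<in>F. \<integral>\<^sup>+x. ennreal (?a S powr q) * indicator (E S) x \<partial>M)
      = (\<integral>\<^sup>+x. (\<Sum>S\<in>F. ennreal (?a S powr q) * indicator (E S) x) \<partial>M)"
    using E(1) by (intro nn_integral_sum[symmetric]) auto
  also have "(\<integral>\<^sup>+x. (\<Sum>S\<in>F. ennreal (?a S powr q) * indicator (E S) x) \<partial>M)
      \<le> (\<integral>\<^sup>+x. ennreal (max_on F ?a x powr q) \<partial>M)"
  proof (rule nn_integral_mono)
    fix x
    show "(\<Sum>S\<in>F. ennreal (?a S powr q) * indicator (E S) x) \<le> ennreal (max_on F ?a x powr q)"
    proof (cases "\<exists>S\<in>F. x \<in> E S")
      case True
      \<comment> \<open>By disjointness \<open>E S\<close> is the only one of these sets containing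
        x, so the sum has one nonzero term at most, and x lies in \<open>S\<close> as well, where
        the maximal function dominates the average.\<close>
      then obtain S where S': "S \<in> F" "x \<in> E S" by auto
      have "x \<notin> E T" if "T \<in> F - {S}" for T
        using that S' E(3) unfolding disjoint_family_on_def by auto
      then have "(\<Sum>S\<in>F. ennreal (?a S powr q) * indicator (E S) x) = ennreal (?a S powr q)"
        using S' F by (subst sum.remove[of _ S]) (auto intro!: sum.neutral)
      also have "\<dots> \<le> ennreal (max_on F ?a x powr q)"
        using max_on_ge[of F S x ?a] F S' E q by (intro ennreal_leI powr_mono2) auto
      finally show ?thesis .
    next
      case False
      then have "(\<Sum>S\<in>F. ennreal (?a S powr q) * indicator (E S) x) = 0"
        by (intro sum.neutral) auto
      then show ?thesis by simp
    qed
  qed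
  also have "\<dots> \<le> ennreal ((2 * q / (q - 1)) powr q) * (\<integral>\<^sup>+x. ennreal (g x powr q) \<partial>M)"
    using F q S g0 by (intro Doob_strong avg_mult_le) auto
  finally show ?thesis by (simp add: mult_left_mono mult.assoc)
qed

section \<open>Dyadic cubes\<close>

text \<open>Turns membership at every scale into a statement about floors, so that nestedness
  becomes integer division.\<close>

lemma mem_dyadic_cube: "x \<in> dyadic_cube k j \<longleftrightarrow> (\<forall>i. \<lfloor>2 powr of_int k * x $ i\<rfloor> = j $ i)"
proof -
  have "2 powr (- of_int k) * a \<le> b \<longleftrightarrow> a \<le> 2 powr of_int k * b"
    "b < 2 powr (- of_int k) * a \<longleftrightarrow> 2 powr of_int k * b < a" for a b :: real
    by (simp_all add: powr_minus field_simps)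
  then show ?thesis
    unfolding dyadic_cube_def by (simp add: floor_eq_iff)
qed

text \<open>Passing from scale k' to the coarser scale k divides by the integer N = 2^(k'-k), and
  the floor of a real divided by N depends only on the floor of that real. Hence the fine index
  determines the coarse one.\<close>

lemma dyadic_cube_mono:
  assumes "k \<le> k'" and x: "x \<in> dyadic_cube k j" "x \<in> dyadic_cube k' j'"
  shows "dyadic_cube k' j' \<subseteq> dyadic_cube k j"
proof
  fix y assume y: "y \<in> dyadic_cube k' j'"
  define N :: int where "N = 2 ^ nat (k' - k)"
  have "(2::real) powr of_int (k - k') = 1 / real_of_int N"
    using assms(1) by (simp add: N_def powr_minus_divide powr_realpow[symmetric] of_nat_nat
        flip: powr_minus_divide)
  then have *: "2 powr of_int k * z = (2 powr of_int k' * z) / real_of_int N" for z :: real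
    by (simp add: powr_diff field_simps)
  have "\<lfloor>2 powr of_int k * z\<rfloor> = \<lfloor>2 powr of_int k' * z\<rfloor> div N" for z :: real
    unfolding * by (rule floor_divide_real_eq_div) (simp add: N_def)
  then show "y \<in> dyadic_cube k j"
    using x y by (simp add: mem_dyadic_cube)
qed

lemma dyadic_grid_nested:
  assumes "Q \<in> dyadic_grid" "R \<in> dyadic_grid"
  shows "Q \<inter> R = {} \<or> Q \<subseteq> R \<or> R \<subseteq> Q"
proof -
  obtain k j k' j' where QR: "Q = dyadic_cube k j" "R = dyadic_cube k' j'"
    using assms by (auto simp: dyadic_grid_def)
  show ?thesis
  proof (cases "Q \<inter> R = {}")
    case False
    then obtain x where "x \<in> Q" "x \<in> R" by auto
    then show ?thesis
      using dyadic_cube_mono[of k k' x j j'] dyadic_cube_mono[of k' k x j' j] QR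
      by (cases "k \<le> k'") auto
  qed simp
qed

lemma laminar_dyadic: "F \<subseteq> dyadic_grid \<Longrightarrow> laminar F"
  unfolding laminar_def using dyadic_grid_nested by blast

lemma countable_dyadic_grid: "countable (dyadic_grid :: (real^'n::finite) set set)"
proof -
  have "dyadic_grid = (\<lambda>(k, j). dyadic_cube k j :: (real^'n) set) ` UNIV"
    by (auto simp: dyadic_grid_def)
  then show ?thesis by (metis countable_image uncountable_def countableI_type)
qed

text \<open>\<open>One\<close> abbreviates the sum of the basis vectors, so this is the coordinate
  rule by which simp resolves membership in the cubes built from \<open>One\<close>.\<close>

lemma sum_Basis_nth [simp]: "(\<Sum>x\<in>(Basis :: (real^'n::finite) set). x $ i) = 1"
proof -
  have ax: "(axis i 1 :: real^'n) \<in> Basis"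
    by (simp add: axis_in_Basis_iff)
  have "(\<Sum>x\<in>(Basis :: (real^'n) set). x $ i) = (\<Sum>x\<in>(Basis :: (real^'n) set). if x = axis i 1 then 1 else 0)"
    using ax inner_Basis[OF _ ax] by (intro sum.cong) (auto simp: inner_axis)
  then show ?thesis using ax by simp
qed

lemma measure_cube:
  fixes a :: "real^'n::finite"
  assumes "0 \<le> l"
  shows "measure lebesgue (cbox a (a + l *\<^sub>R One)) = l ^ CARD('n)"
proof -
  have "a \<in> cbox a (a + l *\<^sub>R One)"
    using assms by (simp add: mem_box_cart)
  then have "measure lborel (cbox a (a + l *\<^sub>R One)) = l ^ CARD('n)"
    by (subst content_cbox_cart) auto
  then show ?thesis by simp
qed

text \<open>Dyadic cubes are half-open while \<open>cubes\<close> consists of closed ones; the open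
  and the closed box have the same volume, which fixes the measure of the cube between them.\<close>

lemma dyadic_cube_sandwich:
  fixes j :: "int^'n::finite" and k :: int
  defines "a \<equiv> \<chi> i. 2 powr (- of_int k) * of_int (j $ i)" and "l \<equiv> 2 powr (- of_int k)"
  shows "box a (a + l *\<^sub>R One) \<subseteq> dyadic_cube k j"
    and "dyadic_cube k j \<subseteq> cbox a (a + l *\<^sub>R One)"
  by (auto simp: mem_box_cart dyadic_cube_def a_def l_def algebra_simps less_imp_le)

lemma sets_dyadic_cube: "dyadic_cube k j \<in> sets (borel :: (real^'n::finite) measure)"
proof -
  have "dyadic_cube k j = {x \<in> space borel. \<forall>i. 2 powr (- of_int k) * of_int (j$i) \<le> x$i \<and>
      x$i < 2 powr (- of_int k) * (of_int (j$i) + 1)}"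
    by (simp add: dyadic_cube_def)
  also have "\<dots> \<in> sets borel"
    by measurable
  finally show ?thesis .
qed

lemma measure_dyadic_cube:
  "measure lebesgue (dyadic_cube k j :: (real^'n::finite) set) = (2 powr (- of_int k)) ^ CARD('n)"
proof -
  define a :: "real^'n" where "a = (\<chi> i. 2 powr (- of_int k) * of_int (j $ i))"
  define l :: real where "l = 2 powr (- of_int k)"
  let ?Q = "dyadic_cube k j :: (real^'n) set"
  have sub: "box a (a + l *\<^sub>R One) \<subseteq> ?Q" "?Q \<subseteq> cbox a (a + l *\<^sub>R One)"
    using dyadic_cube_sandwich[of k j] by (simp_all add: a_def l_def)
  have Q: "?Q \<in> sets lebesgue"
    using sets_dyadic_cube[of k j] by simp
  have "measure lebesgue (box a (a + l *\<^sub>R One)) = measure lebesgue (cbox a (a + l *\<^sub>R One))"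
    by (simp add: measure_lborel_box_eq measure_lborel_cbox_eq)
  moreover have "measure lebesgue ?Q \<le> measure lebesgue (cbox a (a + l *\<^sub>R One))"
    using sub(2) Q by (intro measure_mono_fmeasurable) auto
  moreover have "measure lebesgue (box a (a + l *\<^sub>R One)) \<le> measure lebesgue ?Q"
    using sub Q by (intro measure_mono_fmeasurable)
      (auto intro: fmeasurableI2[of "cbox a (a + l *\<^sub>R One)"])
  ultimately show ?thesis
    using measure_cube[of l a] by (simp add: l_def)
qed

text \<open>The suprema in the Morrey norms and in the A_s constant run over closed cubes. A dyadic
  cube lies in a closed one of equal volume, so these bounds transfer to it without loss.\<close>

lemma dyadic_grid_in_cube:
  fixes Q :: "(real^'n::finite) set"
  assumes "Q \<in> dyadic_grid"
  obtains R where "R \<in> cubes" "Q \<subseteq> R" "measure lebesgue R = measure lebesgue Q"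
proof -
  obtain k j where Q: "Q = dyadic_cube k j"
    using assms by (auto simp: dyadic_grid_def)
  define a :: "real^'n" where "a = (\<chi> i. 2 powr (- of_int k) * of_int (j $ i))"
  define l :: real where "l = 2 powr (- of_int k)"
  have l: "0 < l"
    by (simp add: l_def)
  show ?thesis
  proof (rule that[of "cbox a (a + l *\<^sub>R One)"])
    show "cbox a (a + l *\<^sub>R One) \<in> cubes"
      unfolding cubes_def using l by blast
    show "Q \<subseteq> cbox a (a + l *\<^sub>R One)"
      using dyadic_cube_sandwich(2)[of k j] by (simp add: Q a_def l_def)
    show "measure lebesgue (cbox a (a + l *\<^sub>R One)) = measure lebesgue Q"
      by (subst measure_cube) (simp_all add: Q measure_dyadic_cube l_def)
  qed
qed

lemma measure_dyadic_pos: "Q \<in> dyadic_grid \<Longrightarrow> 0 < measure lebesgue Q"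
  by (auto simp: dyadic_grid_def measure_dyadic_cube)

lemma sets_dyadic [measurable_dest]: "Q \<in> dyadic_grid \<Longrightarrow> Q \<in> sets lebesgue"
  using sets_dyadic_cube by (auto simp: dyadic_grid_def intro!: sets_completionI_sets)

lemma cubes_facts:
  assumes "R \<in> cubes"
  shows "compact R" "R \<in> lmeasurable" "0 < measure lebesgue R"
proof -
  obtain a and l :: real where R: "R = cbox a (a + l *\<^sub>R One)" "0 < l"
    using assms by (auto simp: cubes_def)
  show "compact R" "R \<in> lmeasurable"
    by (simp_all add: R)
  show "0 < measure lebesgue R"
    unfolding R(1) by (subst measure_cube) (use R(2) in auto)
qed

lemma lmeasurable_dyadic: "Q \<in> dyadic_grid \<Longrightarrow> Q \<in> lmeasurable"
  by (metis dyadic_grid_in_cube cubes_facts(2) fmeasurableI2 sets_dyadic)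

lemma emeasure_dyadic: "Q \<in> dyadic_grid \<Longrightarrow> emeasure lebesgue Q = ennreal (measure lebesgue Q)"
  by (intro emeasure_eq_measure2 lmeasurable_dyadic)

lemma cube_dyadic_cover:
  fixes R :: "(real^'n::finite) set"
  assumes "R \<in> cubes"
  obtains q :: "bool^'n \<Rightarrow> (real^'n) set"
    where "\<And>v. q v \<in> dyadic_grid" "R \<subseteq> (\<Union>v. q v)"
      "\<And>v. measure lebesgue (q v) \<le> 2 ^ CARD('n) * measure lebesgue R"
proof -
  obtain a and l :: real where R: "R = cbox a (a + l *\<^sub>R One)" "0 < l"
    using assms by (auto simp: cubes_def)
  \<comment> \<open>The scale with l \<le> 2^(-k) \<le> 2 * l: coarse enough that an interval of
    length l meets at most two dyadic intervals, fine enough that the volume grows by at most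
    2^n.\<close>
  define k where "k = \<lfloor>- log 2 l\<rfloor>"
  have k: "of_int k \<le> - log 2 l" "- log 2 l < of_int k + 1"
    by (simp_all add: k_def)
  have "2 powr of_int k \<le> 2 powr (- log 2 l)" "2 powr (- log 2 l) < 2 powr (of_int k + 1)"
    using k by (auto intro!: powr_mono powr_less_mono)
  then have kl: "2 powr of_int k * l \<le> 1" "2 powr (- of_int k) \<le> 2 * l"
    using R(2) by (simp_all add: powr_minus powr_add field_simps)
  \<comment> \<open>Each coordinate of \<open>v\<close> records which of the two possible dyadic
    intervals is taken.\<close>
  define j where "j = (\<lambda>v::bool^'n. \<chi> i. \<lfloor>2 powr of_int k * a $ i\<rfloor> + (if v $ i then 1 else 0))"
  show ?thesis
  proof (rule that[of "\<lambda>v. dyadic_cube k (j v)"])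
    show "dyadic_cube k (j v) \<in> dyadic_grid" for v
      by (auto simp: dyadic_grid_def)
    show "measure lebesgue (dyadic_cube k (j v)) \<le> 2 ^ CARD('n) * measure lebesgue R" for v
    proof -
      have "(2 powr (- of_int k)) ^ CARD('n) \<le> (2 * l) ^ CARD('n)"
        using kl by (intro power_mono) auto
      then show ?thesis
        unfolding R(1) measure_dyadic_cube using R(2)
        by (subst measure_cube) (auto simp: power_mult_distrib)
    qed
    show "R \<subseteq> (\<Union>v. dyadic_cube k (j v))"
    proof
      fix x assume "x \<in> R"
      then have x: "a $ i \<le> x $ i" "x $ i \<le> a $ i + l" for i
        by (auto simp: R mem_box_cart)
      have "\<lfloor>2 powr of_int k * x $ i\<rfloor> = \<lfloor>2 powr of_int k * a $ i\<rfloor> \<or>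
          \<lfloor>2 powr of_int k * x $ i\<rfloor> = \<lfloor>2 powr of_int k * a $ i\<rfloor> + 1" for i
      proof -
        have "2 powr of_int k * a $ i \<le> 2 powr of_int k * x $ i"
          using x by simp
        moreover have "2 powr of_int k * x $ i \<le> 2 powr of_int k * (a $ i + l)"
          using x by simp
        then have "2 powr of_int k * x $ i \<le> 2 powr of_int k * a $ i + 1"
          using kl by (simp add: distrib_left)
        ultimately show ?thesis by linarith
      qed
      then have "x \<in> dyadic_cube k (j (\<chi> i. \<lfloor>2 powr of_int k * x $ i\<rfloor> \<noteq> \<lfloor>2 powr of_int k * a $ i\<rfloor>))"
        by (auto simp: mem_dyadic_cube j_def)
      then show "x \<in> (\<Union>v. dyadic_cube k (j v))" by blast
    qed
  qed
qed

lemma locally_integrable_nn_integral: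
  assumes "locally_integrable f" "\<And>x. 0 \<le> f x" "Q \<in> dyadic_grid"
  shows "(\<integral>\<^sup>+x\<in>Q. ennreal (f x) \<partial>lebesgue) < \<infinity>"
proof -
  obtain R where R: "R \<in> cubes" "Q \<subseteq> R"
    using dyadic_grid_in_cube[OF assms(3)] by metis
  have "(\<integral>\<^sup>+x\<in>Q. ennreal (f x) \<partial>lebesgue) \<le> (\<integral>\<^sup>+x. ennreal (norm (indicator R x *\<^sub>R f x)) \<partial>lebesgue)"
    using R(2) assms(2) by (intro nn_integral_mono) (auto simp: indicator_def)
  also have "\<dots> < \<infinity>"
    using assms(1) cubes_facts(1)[OF R(1)]
    by (simp add: locally_integrable_def set_integrable_def integrable_iff_bounded)
  finally show ?thesis .
qed

section \<open>Doubling, absorption and products\<close>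

text \<open>For every t > 0 one has 1 \<le> t * w + (t * w)^(-1/(s-1)), since one of the two terms
  is at least 1; where w vanishes the second is read as \<infinity>. Integrating over
  \<open>E\<close> bounds |E| by the mass of \<open>E\<close> and the dual mass of a closed cube
  around \<open>Q\<close>. A choice of t that makes the dual term half of |Q|/2 leaves a lower bound
  for the mass of \<open>E\<close>, and the A_s bound converts it into a multiple of the mass of
  \<open>Q\<close>.\<close>

lemma A_const_doubling:
  fixes w :: "real^'n::finite \<Rightarrow> real"
  assumes w: "w \<in> borel_measurable lebesgue" "\<And>x. 0 \<le> w x"
    and s: "s > 1" and fin: "A_const s w < \<infinity>"
    and Q: "Q \<in> dyadic_grid" and E: "E \<subseteq> Q" "E \<in> sets lebesgue"
      "measure lebesgue Q \<le> 2 * measure lebesgue E"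
  shows "(\<integral>\<^sup>+x\<in>Q. ennreal (w x) \<partial>lebesgue)
    \<le> ennreal (4 powr s * enn2real (A_const s w)) * (\<integral>\<^sup>+x\<in>E. ennreal (w x) \<partial>lebesgue)"
proof -
  note [measurable] = w(1) E(2)
  define \<sigma> where "\<sigma> = (\<lambda>x. if w x = 0 then \<infinity> else ennreal (w x powr (-1 / (s - 1))))"
  have [measurable]: "\<sigma> \<in> borel_measurable lebesgue"
    unfolding \<sigma>_def by measurable
  obtain R where R: "R \<in> cubes" "Q \<subseteq> R" "measure lebesgue R = measure lebesgue Q"
    using dyadic_grid_in_cube[OF Q] .
  have [measurable]: "R \<in> sets lebesgue"
    using cubes_facts(2)[OF R(1)] by auto
  define V where "V = measure lebesgue Q"
  have V: "0 < V" "measure lebesgue R = V"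
    using measure_dyadic_pos[OF Q] R by (simp_all add: V_def)
  obtain A where A: "A_const s w = ennreal A" "0 \<le> A"
    using fin by (cases "A_const s w") auto
  define W where "W = (\<integral>\<^sup>+x\<in>R. ennreal (w x) \<partial>lebesgue)"
  define \<Sigma> where "\<Sigma> = (\<integral>\<^sup>+x\<in>R. \<sigma> x \<partial>lebesgue)"
  define e where "e = (\<integral>\<^sup>+x\<in>E. ennreal (w x) \<partial>lebesgue)"
  have Ale: "(W / ennreal V) * ennpowr (\<Sigma> / ennreal V) (s - 1) \<le> ennreal A"
    unfolding A(1)[symmetric] A_const_def W_def \<Sigma>_def \<sigma>_def
    using SUP_upper[OF R(1)] unfolding V(2)[symmetric] by fast
  have QW: "(\<integral>\<^sup>+x\<in>Q. ennreal (w x) \<partial>lebesgue) \<le> W" and eW: "e \<le> W"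
    unfolding W_def e_def using R(2) E(1) by (intro nn_integral_mono; auto simp: indicator_def)+
  have young: "ennreal (V / 2) \<le> ennreal t * e + ennreal (t powr (-1 / (s - 1))) * \<Sigma>" if "t > 0" for t
  proof -
    have "ennreal (V / 2) \<le> emeasure lebesgue E"
      using E V lmeasurable_dyadic[OF Q]
      by (subst emeasure_eq_measure2) (auto simp: V_def intro: fmeasurableI2 ennreal_leI)
    also have "\<dots> = (\<integral>\<^sup>+x. indicator E x \<partial>lebesgue)"
      by simp
    also have "\<dots> \<le> (\<integral>\<^sup>+x. ennreal t * (ennreal (w x) * indicator E x)
        + ennreal (t powr (-1 / (s - 1))) * (\<sigma> x * indicator R x) \<partial>lebesgue)"
    proof (rule nn_integral_mono)
      fix x
      have "1 \<le> ennreal t * ennreal (w x) + ennreal (t powr (-1 / (s - 1))) * \<sigma> x"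
      proof (cases "w x = 0")
        case True
        then show ?thesis using that by (simp add: \<sigma>_def ennreal_mult_top)
      next
        case False
        then have wx: "w x > 0" using w(2)[of x] by simp
        have "1 \<le> t * w x + (t * w x) powr (-1 / (s - 1))"
        proof (cases "1 \<le> t * w x")
          case True
          then show ?thesis by (simp add: add_increasing2)
        next
          case False
          then have "1 \<le> (t * w x) powr (-1 / (s - 1))"
            using that wx s powr_mono'[of "-1 / (s - 1)" 0 "t * w x"] by simp
          then show ?thesis using that wx by (simp add: add_increasing)
        qed
        then have "ennreal 1 \<le> ennreal (t * w x + t powr (-1 / (s - 1)) * w x powr (-1 / (s - 1)))"
          using that wx by (intro ennreal_leI) (simp add: powr_mult)
        then show ?thesis using that wx False by (simp add: \<sigma>_def ennreal_mult)
      qed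
      then show "indicator E x \<le> ennreal t * (ennreal (w x) * indicator E x)
        + ennreal (t powr (-1 / (s - 1))) * (\<sigma> x * indicator R x)"
        using E(1) R(2) by (cases "x \<in> E") auto
    qed
    also have "\<dots> = ennreal t * e + ennreal (t powr (-1 / (s - 1))) * \<Sigma>"
      unfolding e_def \<Sigma>_def by (subst nn_integral_add) (auto simp: nn_integral_cmult)
    finally show ?thesis .
  qed
  show ?thesis
  proof (cases "W = 0")
    case True
    then show ?thesis using QW by simp
  next
    case False
    \<comment> \<open>With positive mass \<open>W\<close> an infinite dual mass would make the A_s
      constant infinite. It is nonzero too, since \<sigma> vanishes nowhere and the cube has
      positive measure.\<close>
    have "\<Sigma> \<noteq> top"
    proof
      assume "\<Sigma> = top"
      then have "(W / ennreal V) * ennpowr (\<Sigma> / ennreal V) (s - 1) = top"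
        using V False by (simp add: ennreal_top_divide ennreal_mult_top)
      then show False using Ale by (simp add: top_unique)
    qed
    then obtain \<tau> where \<tau>: "\<Sigma> = ennreal \<tau>" "0 \<le> \<tau>" by (cases \<Sigma>) auto
    have "\<tau> \<noteq> 0"
    proof
      assume "\<tau> = 0"
      then have "(\<integral>\<^sup>+x\<in>R. \<sigma> x \<partial>lebesgue) = 0"
        using \<tau> unfolding \<Sigma>_def by simp
      then have "AE x in lebesgue. \<sigma> x * indicator R x = 0"
        by (subst (asm) nn_integral_0_iff_AE) auto
      moreover have "\<sigma> x \<noteq> 0" for x
        using w(2)[of x] by (auto simp: \<sigma>_def)
      ultimately have "AE x in lebesgue. x \<notin> R"
        by (auto simp: indicator_def elim!: eventually_mono)
      then have "emeasure lebesgue R = 0"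
        by (subst (asm) AE_iff_measurable[where N = R]) auto
      then show False using V by (simp add: measure_def)
    qed
    then have \<tau>0: "0 < \<tau>" using \<tau> by simp
    define \<kappa> where "\<kappa> = (\<tau> / V) powr (s - 1)"
    have \<kappa>: "0 < \<kappa>" using V \<tau>0 by (simp add: \<kappa>_def)
    have "ennpowr (\<Sigma> / ennreal V) (s - 1) = ennreal \<kappa>"
      using V \<tau> by (simp add: \<kappa>_def divide_ennreal)
    with Ale have le1: "W / ennreal V * ennreal \<kappa> \<le> ennreal A" by simp
    then have "W \<noteq> top"
      using V \<kappa> by (auto simp: ennreal_top_divide ennreal_top_mult top_unique)
    then obtain b where b: "W = ennreal b" "0 \<le> b" by (cases W) auto
    have "b / V * \<kappa> \<le> A"
      using le1 V \<kappa> b A by (simp add: divide_ennreal flip: ennreal_mult)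
    have "e \<noteq> top" using eW b by (auto simp: top_unique)
    then obtain a where a: "e = ennreal a" "0 \<le> a" by (cases e) auto
    \<comment> \<open>Chosen so that the dual term in \<open>young\<close> equals V / 4, half of the
      left side.\<close>
    define t where "t = (4 * \<tau> / V) powr (s - 1)"
    have t: "0 < t" "t powr (-1 / (s - 1)) * \<tau> = V / 4"
      using \<tau>0 V s by (auto simp: t_def powr_powr powr_neg_one)
    have t2: "t = 4 powr (s - 1) * \<kappa>"
      using \<tau>0 V powr_mult[of 4 "\<tau> / V" "s - 1"] by (simp add: t_def \<kappa>_def)
    have "ennreal (V / 2) \<le> ennreal (t * a + t powr (-1 / (s - 1)) * \<tau>)"
      using young[OF t(1)] a \<tau> t(1) by (simp only: ennreal_plus ennreal_mult mult_nonneg_nonneg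
          powr_ge_zero less_imp_le)
    then have "V / 2 \<le> t * a + V / 4"
      unfolding t(2) using t a V by (subst (asm) ennreal_le_iff) auto
    then have "V \<le> 4 * t * a" by simp
    also have "4 * t = 4 powr s * \<kappa>"
      unfolding t2 using powr_mult_base[of 4 "s - 1"] by simp
    finally have Vle: "V \<le> 4 powr s * \<kappa> * a" .
    have "b = b / V * V" using V by simp
    also have "\<dots> \<le> b / V * (4 powr s * \<kappa> * a)"
      using Vle b V by (intro mult_left_mono) auto
    also have "\<dots> = 4 powr s * (b / V * \<kappa>) * a" by simp
    also have "\<dots> \<le> 4 powr s * A * a"
      using \<open>b / V * \<kappa> \<le> A\<close> a by (intro mult_right_mono mult_left_mono) auto
    finally have "ennreal b \<le> ennreal (4 powr s * A) * ennreal a"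
      using A a by (simp flip: ennreal_mult)
    then show ?thesis
      using QW A unfolding e_def[symmetric] by (simp add: b a)
  qed
qed

text \<open>A finite limit makes the A_s constants finite for all large s; any one such s > 1
  supplies the constant.\<close>

lemma A_infty_doubling:
  assumes "weight w" "A_infty w"
  obtains c where "0 \<le> c"
    "\<And>Q E. Q \<in> dyadic_grid \<Longrightarrow> E \<subseteq> Q \<Longrightarrow> E \<in> sets lebesgue \<Longrightarrow>
      measure lebesgue Q \<le> 2 * measure lebesgue E \<Longrightarrow>
      (\<integral>\<^sup>+x\<in>Q. ennreal (w x) \<partial>lebesgue) \<le> ennreal c * (\<integral>\<^sup>+x\<in>E. ennreal (w x) \<partial>lebesgue)"
proof -
  obtain L where "((\<lambda>s. A_const s w) \<longlongrightarrow> L) at_top" "L < \<infinity>"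
    using assms(2) by (auto simp: A_infty_def)
  then have "\<forall>\<^sub>F s in at_top. A_const s w < \<infinity>"
    by (rule order_tendstoD(2))
  moreover have "\<forall>\<^sub>F s in at_top. (1::real) < s"
    by (rule eventually_gt_at_top)
  ultimately have "\<forall>\<^sub>F s in at_top. A_const s w < \<infinity> \<and> 1 < s"
    by (rule eventually_conj)
  then obtain s where s: "A_const s w < \<infinity>" "1 < s"
    using eventually_happens'[OF trivial_limit_at_top_linorder] by blast
  have w: "w \<in> borel_measurable lebesgue" "\<And>x. 0 \<le> w x"
    using assms(1) by (auto simp: weight_def locally_integrable_def)
  show ?thesis
    using A_const_doubling[OF w s(2,1)] by (intro that[of "4 powr s * enn2real (A_const s w)"]) auto
qed

text \<open>Young's inequality with a free weight \<open>e\<close>. Comparing \<open>b\<close> with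
  \<open>e * T powr (1 / p)\<close>, one of the two terms on the right suffices in each
  case.\<close>

lemma absorb_powr:
  fixes b T p e :: real
  assumes "0 \<le> b" "0 \<le> T" "1 < p" "0 < e"
  shows "b * T powr (1 - 1 / p) \<le> e * T + e powr (1 - p) * b powr p"
proof (cases "b \<le> e * T powr (1 / p)")
  case True
  then have "b * T powr (1 - 1 / p) \<le> e * T powr (1 / p) * T powr (1 - 1 / p)"
    by (intro mult_right_mono) auto
  also have "\<dots> = e * (T powr (1 / p + (1 - 1 / p)))"
    by (simp only: powr_add mult.assoc)
  also have "\<dots> = e * T"
    using assms by simp
  finally show ?thesis by (rule add_increasing2[rotated]) simp
next
  case False
  have "T powr (1 - 1 / p) = (T powr (1 / p)) powr (p - 1)"
    using assms by (simp add: powr_powr field_simps)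
  also have "\<dots> \<le> (b / e) powr (p - 1)"
    using False assms by (intro powr_mono2) (auto simp: field_simps)
  finally have "b * T powr (1 - 1 / p) \<le> b * (b / e) powr (p - 1)"
    using assms by (intro mult_left_mono) auto
  also have "\<dots> = (b * b powr (p - 1)) * e powr (1 - p)"
    using assms by (simp add: powr_divide powr_diff field_simps)
  also have "\<dots> = e powr (1 - p) * b powr p"
    using powr_mult_base[OF assms(1), of "p - 1"] by simp
  finally show ?thesis using assms by (intro add_increasing[rotated]) auto
qed

text \<open>The function is bounded and vanishes off a set of finite measure. This is what permits
  moving part of the integral of J^p to the other side.\<close>

lemma sum_indicator_powr_finite:
  fixes c :: "'a set \<Rightarrow> real"
  assumes "finite F" "\<And>S. S \<in> F \<Longrightarrow> S \<in> sets M" "\<And>S. S \<in> F \<Longrightarrow> emeasure M S < \<infinity>"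
    and "\<And>S. S \<in> F \<Longrightarrow> 0 \<le> c S" "0 < p"
  shows "(\<integral>\<^sup>+x. ennreal ((\<Sum>S\<in>F. c S * indicator S x) powr p) \<partial>M) < \<infinity>"
proof -
  let ?B = "(\<Sum>S\<in>F. c S) powr p"
  have "(\<integral>\<^sup>+x. ennreal ((\<Sum>S\<in>F. c S * indicator S x) powr p) \<partial>M)
      \<le> (\<integral>\<^sup>+x. ennreal ?B * indicator (\<Union>F) x \<partial>M)"
  proof (rule nn_integral_mono)
    fix x
    show "ennreal ((\<Sum>S\<in>F. c S * indicator S x) powr p) \<le> ennreal ?B * indicator (\<Union>F) x"
    proof (cases "x \<in> \<Union>F")
      case True
      have "(\<Sum>S\<in>F. c S * indicator S x) \<le> (\<Sum>S\<in>F. c S)"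
        using assms(4) by (intro sum_mono) (auto simp: indicator_def)
      then show ?thesis
        using True assms by (auto intro!: ennreal_leI powr_mono2 sum_nonneg simp del: Union_iff)
    next
      case False
      then have "(\<Sum>S\<in>F. c S * indicator S x) = 0"
        by (intro sum.neutral) (auto simp: indicator_def)
      then show ?thesis by simp
    qed
  qed
  also have "\<dots> = ennreal ?B * emeasure M (\<Union>F)"
    using assms by (intro nn_integral_cmult_indicator sets.finite_Union) auto
  also have "emeasure M (\<Union>F) \<le> (\<Sum>S\<in>F. emeasure M S)"
    using emeasure_subadditive_finite[of F "\<lambda>S. S" M] assms by auto
  finally have "(\<integral>\<^sup>+x. ennreal ((\<Sum>S\<in>F. c S * indicator S x) powr p) \<partial>M)
      \<le> ennreal ?B * (\<Sum>S\<in>F. emeasure M S)"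
    by (simp add: mult_left_mono)
  also have "\<dots> < \<infinity>"
    using assms by (simp add: ennreal_mult_less_top)
  finally show ?thesis .
qed

text \<open>Expanding one factor of \<open>J\<^sup>p = J \<cdot> J\<^sup>p\<^sup>-\<^sup>1\<close> replaces duality; the power of \<open>J\<close> on the right is
  absorbed, which is legitimate since the sum is finite.\<close>

lemma sparse_form_absorption:
  fixes c b T :: "'a set \<Rightarrow> real"
  defines "J \<equiv> \<lambda>F x. \<Sum>S\<in>F. c S * indicator S x"
  assumes F: "finite F" "\<And>S. S \<in> F \<Longrightarrow> S \<in> sets M" "\<And>S. S \<in> F \<Longrightarrow> emeasure M S < \<infinity>"
    and nn: "\<And>S. S \<in> F \<Longrightarrow> 0 \<le> c S" "\<And>S. S \<in> F \<Longrightarrow> 0 \<le> b S" "\<And>S. S \<in> F \<Longrightarrow> 0 \<le> T S"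
    and p: "1 < p" and C: "0 < C"
    and le: "\<And>S. S \<in> F \<Longrightarrow> ennreal (c S) * (\<integral>\<^sup>+x\<in>S. ennreal (J F x powr (p - 1)) \<partial>M)
        \<le> ennreal (b S * T S powr (1 - 1 / p))"
    and T: "(\<Sum>S\<in>F. ennreal (T S)) \<le> ennreal C * (\<integral>\<^sup>+x. ennreal (J F x powr p) \<partial>M)"
  shows "(\<integral>\<^sup>+x. ennreal (J F x powr p) \<partial>M)
    \<le> ennreal (2 * (2 * C) powr (p - 1)) * (\<Sum>S\<in>F. ennreal (b S powr p))"
proof -
  have [measurable]: "J F \<in> borel_measurable M"
    using F(2) unfolding J_def by (intro borel_measurable_sum) auto
  have J0: "0 \<le> J F x" for x
    using nn by (auto simp: J_def intro!: sum_nonneg)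
  have "(\<integral>\<^sup>+x. ennreal (J F x powr p) \<partial>M) < \<infinity>"
    unfolding J_def using F nn p by (intro sum_indicator_powr_finite) auto
  then obtain X where X: "(\<integral>\<^sup>+x. ennreal (J F x powr p) \<partial>M) = ennreal X" "0 \<le> X"
    by (cases "\<integral>\<^sup>+x. ennreal (J F x powr p) \<partial>M") auto
  have "ennreal (\<Sum>S\<in>F. T S) \<le> ennreal (C * X)"
    using T X C nn by (simp add: sum_ennreal ennreal_mult)
  then have TX: "(\<Sum>S\<in>F. T S) \<le> C * X"
    using X C by (subst (asm) ennreal_le_iff) auto
  \<comment> \<open>With this weight the \<open>T\<close> terms add up to at most X / 2, half of the
    left side, and e^(1-p) becomes the constant of the conclusion.\<close>
  define e where "e = 1 / (2 * C)"
  have e: "0 < e" "e powr (1 - p) = (2 * C) powr (p - 1)"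
    using C by (auto simp: e_def powr_divide powr_minus_divide[symmetric])
  have "ennreal X = (\<integral>\<^sup>+x. (\<Sum>S\<in>F. ennreal (c S) * (ennreal (J F x powr (p - 1)) * indicator S x)) \<partial>M)"
    unfolding X(1)[symmetric]
  proof (rule nn_integral_cong)
    fix x
    have "J F x powr p = (\<Sum>S\<in>F. c S * indicator S x) * J F x powr (p - 1)"
      using powr_mult_base[OF J0, of x "p - 1"] by (simp add: J_def)
    also have "\<dots> = (\<Sum>S\<in>F. c S * (J F x powr (p - 1) * indicator S x))"
      by (simp add: sum_distrib_left sum_distrib_right ac_simps)
    also have "ennreal \<dots> = (\<Sum>S\<in>F. ennreal (c S * (J F x powr (p - 1) * indicator S x)))"
      using nn by (intro sum_ennreal[symmetric]) auto
    also have "\<dots> = (\<Sum>S\<in>F. ennreal (c S) * (ennreal (J F x powr (p - 1)) * indicator S x))"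
      using nn by (intro sum.cong) (auto simp: ennreal_mult indicator_def)
    finally show "ennreal (J F x powr p) = \<dots>" .
  qed
  also have "\<dots> = (\<Sum>S\<in>F. \<integral>\<^sup>+x. ennreal (c S) * (ennreal (J F x powr (p - 1)) * indicator S x) \<partial>M)"
    using F(2) by (intro nn_integral_sum) auto
  also have "\<dots> = (\<Sum>S\<in>F. ennreal (c S) * (\<integral>\<^sup>+x\<in>S. ennreal (J F x powr (p - 1)) \<partial>M))"
    using F(2) by (intro sum.cong nn_integral_cmult) auto
  also have "\<dots> \<le> (\<Sum>S\<in>F. ennreal (e * T S + e powr (1 - p) * b S powr p))"
  proof (rule sum_mono)
    fix S assume S: "S \<in> F"
    show "ennreal (c S) * (\<integral>\<^sup>+x\<in>S. ennreal (J F x powr (p - 1)) \<partial>M)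
        \<le> ennreal (e * T S + e powr (1 - p) * b S powr p)"
      using le[OF S] ennreal_leI[OF absorb_powr[OF nn(2)[OF S] nn(3)[OF S] p e(1)]] by (rule order_trans)
  qed
  also have "\<dots> = ennreal (\<Sum>S\<in>F. e * T S + e powr (1 - p) * b S powr p)"
    using nn e by (intro sum_ennreal) (auto intro!: add_nonneg_nonneg mult_nonneg_nonneg)
  finally have "X \<le> (\<Sum>S\<in>F. e * T S + e powr (1 - p) * b S powr p)"
    using nn e by (subst (asm) ennreal_le_iff) (auto intro!: sum_nonneg add_nonneg_nonneg mult_nonneg_nonneg)
  also have "\<dots> = e * (\<Sum>S\<in>F. T S) + (2 * C) powr (p - 1) * (\<Sum>S\<in>F. b S powr p)"
    by (simp add: sum.distrib sum_distrib_left e)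
  also have "e * (\<Sum>S\<in>F. T S) \<le> e * (C * X)"
    using TX e by (intro mult_left_mono) auto
  also have "e * (C * X) = X / 2"
    using C by (simp add: e_def)
  finally have "X \<le> 2 * (2 * C) powr (p - 1) * (\<Sum>S\<in>F. b S powr p)"
    by simp
  then have "ennreal X \<le> ennreal (2 * (2 * C) powr (p - 1)) * ennreal (\<Sum>S\<in>F. b S powr p)"
    by (subst ennreal_mult[symmetric]) (auto intro!: sum_nonneg ennreal_leI)
  then show ?thesis
    unfolding X(1) by (simp add: sum_ennreal)
qed

text \<open>A discrete Hoelder inequality with exponents P i / p. After normalising by
  \<open>N i\<close>, each factor is bounded by the sum ?T of all normalised factors; since the
  numbers p / P i add up to 1, the product of the powers of ?T is ?T itself. This produces the sum
  of the \<open>C i\<close> as the constant. A vanishing \<open>N i\<close> kills the left side, and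
  an infinite one, with no \<open>N i\<close> zero, makes the right side infinite.\<close>

lemma sum_prod_powr_le:
  fixes a :: "nat \<Rightarrow> 'a \<Rightarrow> real" and v :: "'a \<Rightarrow> real" and N :: "nat \<Rightarrow> ennreal"
  assumes F: "finite F" and v: "\<And>S. S \<in> F \<Longrightarrow> 0 < v S"
    and a: "\<And>i S. i < m \<Longrightarrow> S \<in> F \<Longrightarrow> 0 \<le> a i S"
    and P: "\<And>i. i < m \<Longrightarrow> 1 < P i" and p: "1 < p" "1 / p = (\<Sum>i<m. 1 / P i)"
    and C: "\<And>i. i < m \<Longrightarrow> 0 < C i"
    and le: "\<And>i. i < m \<Longrightarrow> (\<Sum>S\<in>F. ennreal (a i S powr P i * v S)) \<le> ennreal (C i) * N i"
  shows "(\<Sum>S\<in>F. ennreal (v S * (\<Prod>i<m. a i S) powr p))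
    \<le> ennreal (\<Sum>i<m. C i) * (\<Prod>i<m. ennpowr (N i) (p / P i))"
proof -
  \<comment> \<open>For m = 0 the empty sum would give 1 / p = 0.\<close>
  have m: "m \<noteq> 0" using p by (intro notI) auto
  then have CC: "0 < (\<Sum>i<m. C i)" using C by (intro sum_pos) auto
  consider i where "i < m" "N i = 0" | i where "i < m" "N i = top" "\<And>i. i < m \<Longrightarrow> N i \<noteq> 0"
    | "\<And>i. i < m \<Longrightarrow> N i \<noteq> 0 \<and> N i \<noteq> top"
    by blast
  then show ?thesis
  proof cases
    case (1 i)
    have "a i S = 0" if "S \<in> F" for S
    proof -
      have "ennreal (a i S powr P i * v S) = 0"
        using le[OF 1(1)] 1(2) that F by (simp add: sum_eq_0_iff)
      then show ?thesis using v[OF that] a[OF 1(1) that]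
        by (metis ennreal_eq_0_iff mult_eq_0_iff mult_nonneg_nonneg powr_ge_zero powr_eq_0_iff
            less_imp_le order_less_irrefl order_antisym)
    qed
    then have "(\<Prod>i<m. a i S) = 0" if "S \<in> F" for S
      using that 1(1) by (intro prod_zero) auto
    then have "(\<Sum>S\<in>F. ennreal (v S * (\<Prod>i<m. a i S) powr p)) = 0"
      by (intro sum.neutral ballI) (simp only: powr_0 mult_zero_right ennreal_0)
    then show ?thesis by simp
  next
    case (2 i)
    then have "(\<Prod>i<m. ennpowr (N i) (p / P i)) = top"
      by (subst ennreal_prod_eq_top) auto
    then show ?thesis using CC by (simp add: ennreal_mult_top)
  next
    case 3
    define n where "n = (\<lambda>i. enn2real (N i))"
    have n: "N i = ennreal (n i)" "0 < n i" if "i < m" for i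
      using 3[OF that] by (auto simp: n_def enn2real_positive_iff less_top zero_less_iff_neq_zero)
    have le': "(\<Sum>S\<in>F. a i S powr P i * v S) \<le> C i * n i" if "i < m" for i
    proof -
      have "ennreal (\<Sum>S\<in>F. a i S powr P i * v S) \<le> ennreal (C i * n i)"
        using le[OF that] C[OF that] n[OF that] v
        by (subst sum_ennreal[symmetric]) (auto simp: ennreal_mult less_imp_le)
      then show ?thesis using C[OF that] n[OF that] by (subst (asm) ennreal_le_iff) auto
    qed
    define B where "B = (\<Prod>i<m. n i powr (p / P i))"
    have B: "0 \<le> B" by (auto simp: B_def intro!: prod_nonneg)
    have pt: "(\<Prod>i<m. a i S) powr p \<le> (\<Sum>i<m. a i S powr P i / n i) * B" if S: "S \<in> F" for S
    proof -
      let ?T = "\<Sum>i<m. a i S powr P i / n i"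
      have T0: "0 \<le> ?T" using n by (intro sum_nonneg) (auto simp: less_imp_le)
      have "(\<Prod>i<m. a i S) powr p = (\<Prod>i<m. a i S powr p)"
        by (rule prod_powr_distrib)
      also have "\<dots> = (\<Prod>i<m. (a i S powr P i / n i) powr (p / P i) * n i powr (p / P i))"
      proof (rule prod.cong)
        fix i assume "i \<in> {..<m}"
        then have i: "i < m" by simp
        have "(a i S powr P i / n i) powr (p / P i) * n i powr (p / P i) = (a i S powr P i) powr (p / P i)"
          using n[OF i] by (simp add: powr_divide)
        also have "\<dots> = a i S powr p"
          using P[OF i] by (simp add: powr_powr)
        finally show "a i S powr p = (a i S powr P i / n i) powr (p / P i) * n i powr (p / P i)" by simp
      qed simp
      also have "\<dots> = (\<Prod>i<m. (a i S powr P i / n i) powr (p / P i)) * B"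
        by (simp add: prod.distrib B_def)
      also have "(\<Prod>i<m. (a i S powr P i / n i) powr (p / P i)) \<le> (\<Prod>i<m. ?T powr (p / P i))"
      proof (intro prod_mono conjI powr_mono2)
        fix i assume "i \<in> {..<m}"
        then have i: "i < m" by simp
        show "0 \<le> p / P i" using P[OF i] p by auto
        show "0 \<le> a i S powr P i / n i" using n[OF i] by simp
        show "a i S powr P i / n i \<le> ?T"
          using n i by (intro member_le_sum) (auto simp: less_imp_le)
      qed auto
      also have "(\<Prod>i<m. ?T powr (p / P i)) = ?T powr (\<Sum>i<m. p / P i)"
      proof (cases "?T = 0")
        case True
        have "(\<Prod>i<m. ?T powr (p / P i)) = 0"
          using m unfolding True by (intro prod_zero) auto
        then show ?thesis unfolding True by simp
      next
        case False
        then show ?thesis by (intro powr_sum[symmetric]) auto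
      qed
      also have "(\<Sum>i<m. p / P i) = 1"
      proof -
        have "(\<Sum>i<m. p / P i) = p * (\<Sum>i<m. 1 / P i)"
          by (simp add: sum_distrib_left)
        then show ?thesis using p(1) by (simp flip: p(2))
      qed
      also have "?T powr 1 = ?T" using T0 by simp
      finally show ?thesis using B by (simp add: mult_right_mono)
    qed
    have "(\<Sum>S\<in>F. v S * (\<Prod>i<m. a i S) powr p) \<le> (\<Sum>S\<in>F. v S * ((\<Sum>i<m. a i S powr P i / n i) * B))"
      using pt v by (intro sum_mono mult_left_mono) (auto simp: less_imp_le)
    also have "\<dots> = (\<Sum>S\<in>F. \<Sum>i<m. (a i S powr P i * v S) / n i) * B"
      by (simp add: sum_distrib_left sum_distrib_right ac_simps)
    also have "(\<Sum>S\<in>F. \<Sum>i<m. (a i S powr P i * v S) / n i) = (\<Sum>i<m. (\<Sum>S\<in>F. a i S powr P i * v S) / n i)"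
      by (subst sum.swap) (simp add: sum_divide_distrib)
    also have "\<dots> \<le> (\<Sum>i<m. C i)"
    proof (rule sum_mono)
      fix i assume "i \<in> {..<m}"
      then show "(\<Sum>S\<in>F. a i S powr P i * v S) / n i \<le> C i"
        using le'[of i] n[of i] by (simp add: pos_divide_le_eq)
    qed
    finally have "(\<Sum>S\<in>F. v S * (\<Prod>i<m. a i S) powr p) \<le> (\<Sum>i<m. C i) * B"
      using B by (simp add: mult_right_mono)
    then have "ennreal (\<Sum>S\<in>F. v S * (\<Prod>i<m. a i S) powr p) \<le> ennreal ((\<Sum>i<m. C i) * B)"
      by (rule ennreal_leI)
    also have "\<dots> = ennreal (\<Sum>i<m. C i) * ennreal B"
      using CC B by (intro ennreal_mult) auto
    also have "ennreal B = (\<Prod>i<m. ennpowr (N i) (p / P i))"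
      unfolding B_def using n by (subst prod_ennreal[symmetric]) (auto simp: less_imp_le)
    finally show ?thesis
      using v by (subst sum_ennreal) (auto simp: less_imp_le)
  qed
qed

section \<open>Cubes inside a fixed dyadic cube\<close>

lemma nn_integral_eq_avg:
  assumes "S \<in> dyadic_grid" "(\<integral>\<^sup>+x\<in>S. ennreal (g x) \<partial>lebesgue) < \<infinity>"
  shows "(\<integral>\<^sup>+x\<in>S. ennreal (g x) \<partial>lebesgue) = ennreal (avg lebesgue g S * measure lebesgue S)"
  using assms measure_dyadic_pos[OF assms(1)] by (simp add: avg_def)

definition Carleson_const :: "real \<Rightarrow> real" where
  "Carleson_const q = (2 * q / (q - 1)) powr q"

lemma Carleson_const_pos: "1 < q \<Longrightarrow> 0 < Carleson_const q"
  by (simp add: Carleson_const_def)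

text \<open>Exposes the choice of the sets \<open>E S\<close>, which \<open>sparse\<close> hides
  under a quantifier, so that all finite subfamilies share one choice.\<close>

definition sparse_on :: "((real^'n::finite) set \<Rightarrow> (real^'n) set) \<Rightarrow> (real^'n) set set \<Rightarrow> bool" where
  "sparse_on E F \<longleftrightarrow> F \<subseteq> dyadic_grid \<and> (\<forall>S\<in>F. E S \<subseteq> S \<and> E S \<in> sets lebesgue \<and>
     measure lebesgue S \<le> 2 * measure lebesgue (E S)) \<and> disjoint_family_on E F"

lemma sparse_on_subset: "sparse_on E F \<Longrightarrow> G \<subseteq> F \<Longrightarrow> sparse_on E G"
  unfolding sparse_on_def by (auto intro: disjoint_family_on_mono)

lemma sparse_imp_sparse_on: "sparse F \<Longrightarrow> \<exists>E. sparse_on E F"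
  unfolding sparse_def sparse_on_def by blast

lemma Carleson_sparse_lebesgue:
  assumes F: "finite F" "sparse_on E F" and q: "1 < q"
    and g: "g \<in> borel_measurable lebesgue" "\<And>x. 0 \<le> g x"
  shows "(\<Sum>S\<in>F. ennreal (avg lebesgue g S powr q * measure lebesgue S))
    \<le> ennreal (2 * Carleson_const q) * (\<integral>\<^sup>+x. ennreal (g x powr q) \<partial>lebesgue)"
proof -
  have D: "S \<in> dyadic_grid" if "S \<in> F" for S
    using F that by (auto simp: sparse_on_def)
  have "(\<Sum>S\<in>F. ennreal (avg lebesgue g S powr q) * emeasure lebesgue S)
    \<le> ennreal 2 * ennreal ((2 * q / (q - 1)) powr q) * (\<integral>\<^sup>+x. ennreal (g x powr q) \<partial>lebesgue)"
  proof (rule Carleson_embedding[OF F(1) _ q _ _ g])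
    show "laminar F"
      using F by (intro laminar_dyadic) (auto simp: sparse_on_def)
    show "disjoint_family_on E F"
      using F by (auto simp: sparse_on_def)
    fix S assume S: "S \<in> F"
    show "S \<in> sets lebesgue" "emeasure lebesgue S < \<infinity>"
      using lmeasurable_dyadic[OF D[OF S]] by (auto simp: fmeasurable_def)
    show E: "E S \<in> sets lebesgue" "E S \<subseteq> S"
      using F S by (auto simp: sparse_on_def)
    have "E S \<in> lmeasurable"
      using fmeasurableI2[OF lmeasurable_dyadic[OF D[OF S]] E(2,1)] .
    then have "emeasure lebesgue (E S) = ennreal (measure lebesgue (E S))"
      by (rule emeasure_eq_measure2)
    moreover have "measure lebesgue S \<le> 2 * measure lebesgue (E S)"
      using F S by (auto simp: sparse_on_def)
    then have "ennreal (measure lebesgue S) \<le> ennreal 2 * ennreal (measure lebesgue (E S))"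
      by (subst ennreal_mult[symmetric]) (auto intro: ennreal_leI)
    ultimately show "emeasure lebesgue S \<le> ennreal 2 * emeasure lebesgue (E S)"
      using emeasure_dyadic[OF D[OF S]] by metis
  qed
  moreover have "(\<Sum>S\<in>F. ennreal (avg lebesgue g S powr q * measure lebesgue S))
      = (\<Sum>S\<in>F. ennreal (avg lebesgue g S powr q) * emeasure lebesgue S)"
  proof (rule sum.cong)
    fix S assume "S \<in> F"
    show "ennreal (avg lebesgue g S powr q * measure lebesgue S)
        = ennreal (avg lebesgue g S powr q) * emeasure lebesgue S"
      unfolding emeasure_dyadic[OF D[OF \<open>S \<in> F\<close>]] by (rule ennreal_mult) auto
  qed simp
  ultimately show ?thesis
    by (simp add: Carleson_const_def ennreal_mult)
qed

lemma Carleson_sparse_prod: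
  fixes f :: "nat \<Rightarrow> real^'n::finite \<Rightarrow> real"
  assumes F: "finite F" "sparse_on E F" "\<And>S. S \<in> F \<Longrightarrow> S \<subseteq> Q" and Q: "Q \<in> dyadic_grid"
    and P: "\<And>i. i < m \<Longrightarrow> 1 < P i" and p: "1 < p" "1 / p = (\<Sum>i<m. 1 / P i)"
    and f: "\<And>i. i < m \<Longrightarrow> f i \<in> borel_measurable lebesgue" "\<And>i x. i < m \<Longrightarrow> 0 \<le> f i x"
  shows "(\<Sum>S\<in>F. ennreal (measure lebesgue S * (\<Prod>i<m. avg lebesgue (f i) S) powr p))
    \<le> ennreal (\<Sum>i<m. 2 * Carleson_const (P i)) *
      (\<Prod>i<m. ennpowr (\<integral>\<^sup>+x\<in>Q. ennreal (f i x powr P i) \<partial>lebesgue) (p / P i))"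
proof (rule sum_prod_powr_le[OF F(1) _ _ P p])
  fix S assume "S \<in> F"
  then show "0 < measure lebesgue S"
    using F measure_dyadic_pos by (auto simp: sparse_on_def)
next
  fix i assume i: "i < m"
  note [measurable] = f(1)[OF i] sets_dyadic[OF Q]
  show "0 < 2 * Carleson_const (P i)"
    using Carleson_const_pos[OF P[OF i]] by simp
  \<comment> \<open>Cutting \<open>f i\<close> off outside \<open>Q\<close> leaves the averages over
    subcubes of \<open>Q\<close> unchanged and turns the global norm in the embedding into a local
    one.\<close>
  let ?g = "\<lambda>x. f i x * indicator Q x"
  have "avg lebesgue ?g S = avg lebesgue (f i) S" if "S \<in> F" for S
  proof -
    have "(\<integral>\<^sup>+x\<in>S. ennreal (?g x) \<partial>lebesgue) = (\<integral>\<^sup>+x\<in>S. ennreal (f i x) \<partial>lebesgue)"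
      using F(3)[OF that] by (intro nn_integral_cong) (auto simp: indicator_def)
    then show ?thesis by (simp add: avg_def)
  qed
  then have "(\<Sum>S\<in>F. ennreal (avg lebesgue (f i) S powr P i * measure lebesgue S))
      = (\<Sum>S\<in>F. ennreal (avg lebesgue ?g S powr P i * measure lebesgue S))"
    by simp
  also have "\<dots> \<le> ennreal (2 * Carleson_const (P i)) * (\<integral>\<^sup>+x. ennreal (?g x powr P i) \<partial>lebesgue)"
    using f(2)[OF i] by (intro Carleson_sparse_lebesgue[OF F(1,2) P[OF i]]) auto
  also have "(\<integral>\<^sup>+x. ennreal (?g x powr P i) \<partial>lebesgue) = (\<integral>\<^sup>+x\<in>Q. ennreal (f i x powr P i) \<partial>lebesgue)"
    by (intro nn_integral_cong) (auto simp: indicator_def)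
  finally show "(\<Sum>S\<in>F. ennreal (avg lebesgue (f i) S powr P i * measure lebesgue S))
    \<le> ennreal (2 * Carleson_const (P i)) * (\<integral>\<^sup>+x\<in>Q. ennreal (f i x powr P i) \<partial>lebesgue)" .
qed simp

text \<open>A real-valued finite counterpart of \<open>sparse_op\<close>: the integral of
  \<open>f i\<close> over S is written as its average times |S|, which accounts for |S|^m. The two
  agree on finite families of dyadic cubes when K is nonnegative there and the \<open>f i\<close>
  are nonnegative and locally integrable.\<close>

definition sparse_sum :: "((real^'n::finite) set \<Rightarrow> real) \<Rightarrow> (real^'n) set set \<Rightarrow> nat \<Rightarrow>
    (nat \<Rightarrow> real^'n \<Rightarrow> real) \<Rightarrow> real^'n \<Rightarrow> real" where
  "sparse_sum K F m f x = (\<Sum>S\<in>F. (K S * measure lebesgue S ^ m * (\<Prod>i<m. avg lebesgue (f i) S)) * indicator S x)"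

text \<open>The setting common to both hypotheses on \<mu>; \<alpha> is the finite value of A0. The
  testing bounds themselves differ and enter as assumptions of the lemmas below.\<close>

locale sparse_testing =
  fixes m :: nat and \<mu> :: "real^'n::finite \<Rightarrow> real" and K :: "(real^'n) set \<Rightarrow> real"
    and P :: "nat \<Rightarrow> real" and p :: real
    and F :: "(real^'n) set set" and E :: "(real^'n) set \<Rightarrow> (real^'n) set"
    and Q :: "(real^'n) set" and f :: "nat \<Rightarrow> real^'n \<Rightarrow> real" and \<alpha> :: real
  assumes mu: "weight \<mu>"
    and K: "\<And>S. S \<in> dyadic_grid \<Longrightarrow> 0 \<le> K S"
    and P: "\<And>i. i < m \<Longrightarrow> 1 < P i" and p: "1 < p" "1 / p = (\<Sum>i<m. 1 / P i)"
    and F: "finite F" "sparse_on E F" "\<And>S. S \<in> F \<Longrightarrow> S \<subseteq> Q" and Q: "Q \<in> dyadic_grid"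
    and f: "\<And>i. i < m \<Longrightarrow> f i \<in> borel_measurable lebesgue" "\<And>i x. i < m \<Longrightarrow> 0 \<le> f i x"
    and \<alpha>: "0 \<le> \<alpha>"
begin

abbreviation "J \<equiv> sparse_sum K F m f"

abbreviation "M \<equiv> density lebesgue (\<lambda>x. ennreal (\<mu> x))"

abbreviation "V \<equiv> measure lebesgue"

definition "D = (\<Sum>i<m. 2 * Carleson_const (P i))"

text \<open>The p-th power of the product of the L^(P i) norms of the \<open>f i\<close> over
  \<open>Q\<close>.\<close>

definition "N = (\<Prod>i<m. ennpowr (\<integral>\<^sup>+x\<in>Q. ennreal (f i x powr P i) \<partial>lebesgue) (p / P i))"

lemma mu_measurable [measurable]: "\<mu> \<in> borel_measurable lebesgue"
  and mu_nonneg: "0 \<le> \<mu> x"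
  using mu by (auto simp: weight_def locally_integrable_def)

lemma F_dyadic: "S \<in> F \<Longrightarrow> S \<in> dyadic_grid"
  using F by (auto simp: sparse_on_def)

lemma F_sets [measurable_dest]: "S \<in> F \<Longrightarrow> S \<in> sets lebesgue"
  using F_dyadic sets_dyadic by blast

lemma V_pos: "S \<in> F \<Longrightarrow> 0 < V S"
  using F_dyadic measure_dyadic_pos by blast

lemma K_nonneg: "S \<in> F \<Longrightarrow> 0 \<le> K S"
  using F_dyadic K by blast

lemma emeasure_M: "S \<in> sets lebesgue \<Longrightarrow> emeasure M S = (\<integral>\<^sup>+x\<in>S. ennreal (\<mu> x) \<partial>lebesgue)"
  by (simp add: emeasure_density)

lemma emeasure_M_finite: "S \<in> F \<Longrightarrow> emeasure M S < \<infinity>"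
  using locally_integrable_nn_integral[of \<mu> S] mu F_dyadic[of S] mu_nonneg
  by (simp add: emeasure_M F_sets weight_def)

lemma J_measurable [measurable]: "J \<in> borel_measurable lebesgue"
  unfolding sparse_sum_def[abs_def] using F_sets by (intro borel_measurable_sum) auto

lemma J_powr_finite: "0 < s \<Longrightarrow> (\<integral>\<^sup>+x. ennreal (J x powr s) \<partial>M) < \<infinity>"
  unfolding sparse_sum_def using F_sets K_nonneg F emeasure_M_finite
  by (intro sum_indicator_powr_finite mult_nonneg_nonneg prod_nonneg) auto

text \<open>The terms \<open>T S\<close> are left open: each hypothesis on \<mu> supplies its own
  Carleson terms, and absorption and the bound by the \<open>f i\<close> are then done once for
  both.\<close>

lemma small_part:
  assumes C: "0 < C" and T: "\<And>S. S \<in> F \<Longrightarrow> 0 \<le> T S"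
    and le: "\<And>S. S \<in> F \<Longrightarrow> ennreal (K S * V S ^ m) * (\<integral>\<^sup>+x\<in>S. ennreal (J x powr (p - 1)) \<partial>M)
      \<le> ennreal (\<alpha> * V S powr (1 / p) * T S powr (1 - 1 / p))"
    and TC: "(\<Sum>S\<in>F. ennreal (T S)) \<le> ennreal C * (\<integral>\<^sup>+x. ennreal (J x powr p) \<partial>M)"
  shows "(\<integral>\<^sup>+x. ennreal (J x powr p) \<partial>M) \<le> ennreal (2 * (2 * C) powr (p - 1) * D * \<alpha> powr p) * N"
proof -
  define A where "A = (\<lambda>S. \<Prod>i<m. avg lebesgue (f i) S)"
  have A: "0 \<le> A S" for S by (auto simp: A_def intro!: prod_nonneg)
  \<comment> \<open>The factor |S|^(1/p) becomes |S| in the p-th power, so the powers of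
    \<open>b S\<close> form the sum controlled by \<open>Carleson_sparse_prod\<close>.\<close>
  define b where "b = (\<lambda>S. \<alpha> * V S powr (1 / p) * A S)"
  have D0: "0 \<le> D"
    unfolding D_def using Carleson_const_pos[OF P] by (intro sum_nonneg) (auto simp: less_imp_le)
  have J: "sparse_sum K F m f = (\<lambda>x. \<Sum>S\<in>F. (K S * V S ^ m * A S) * indicator S x)"
    by (simp add: sparse_sum_def A_def fun_eq_iff)
  have "(\<integral>\<^sup>+x. ennreal (J x powr p) \<partial>M)
      \<le> ennreal (2 * (2 * C) powr (p - 1)) * (\<Sum>S\<in>F. ennreal (b S powr p))"
    unfolding J
  proof (rule sparse_form_absorption[OF F(1) _ _ _ _ T p(1) C])
    fix S assume S: "S \<in> F"
    show "S \<in> sets M" "emeasure M S < \<infinity>"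
      using F_sets[OF S] emeasure_M_finite[OF S] by auto
    show "0 \<le> K S * V S ^ m * A S" "0 \<le> b S"
      using K_nonneg[OF S] A \<alpha> by (auto simp: b_def)
    have "ennreal (K S * V S ^ m * A S) * (\<integral>\<^sup>+x\<in>S. ennreal (J x powr (p - 1)) \<partial>M)
        = ennreal (A S) * (ennreal (K S * V S ^ m) * (\<integral>\<^sup>+x\<in>S. ennreal (J x powr (p - 1)) \<partial>M))"
      using K_nonneg[OF S] A by (simp add: ennreal_mult ac_simps)
    also have "\<dots> \<le> ennreal (A S) * ennreal (\<alpha> * V S powr (1 / p) * T S powr (1 - 1 / p))"
      using le[OF S] by (rule mult_left_mono) simp
    also have "\<dots> = ennreal (b S * T S powr (1 - 1 / p))"
      using A \<alpha> by (simp add: b_def ac_simps flip: ennreal_mult)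
    finally show "ennreal (K S * V S ^ m * A S) *
        (\<integral>\<^sup>+x\<in>S. ennreal ((\<Sum>S\<in>F. K S * V S ^ m * A S * indicator S x) powr (p - 1)) \<partial>M)
        \<le> ennreal (b S * T S powr (1 - 1 / p))"
      unfolding J .
  next
    show "(\<Sum>S\<in>F. ennreal (T S)) \<le> ennreal C *
        (\<integral>\<^sup>+x. ennreal ((\<Sum>S\<in>F. K S * V S ^ m * A S * indicator S x) powr p) \<partial>M)"
      using TC unfolding J .
  qed
  also have "(\<Sum>S\<in>F. ennreal (b S powr p)) = (\<Sum>S\<in>F. ennreal (\<alpha> powr p) * ennreal (V S * A S powr p))"
  proof (rule sum.cong)
    fix S assume S: "S \<in> F"
    have "b S powr p = \<alpha> powr p * (V S * A S powr p)"
      using A[of S] \<alpha> V_pos[OF S] p(1) by (simp add: b_def powr_mult powr_powr)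
    then show "ennreal (b S powr p) = ennreal (\<alpha> powr p) * ennreal (V S * A S powr p)"
      using V_pos[OF S] by (simp add: ennreal_mult)
  qed simp
  also have "\<dots> = ennreal (\<alpha> powr p) * (\<Sum>S\<in>F. ennreal (V S * A S powr p))"
    by (rule sum_distrib_left[symmetric])
  also have "(\<Sum>S\<in>F. ennreal (V S * A S powr p)) \<le> ennreal D * N"
    unfolding A_def D_def N_def by (rule Carleson_sparse_prod[OF F Q P p f])
  finally have "(\<integral>\<^sup>+x. ennreal (J x powr p) \<partial>M)
      \<le> ennreal (2 * (2 * C) powr (p - 1)) * (ennreal (\<alpha> powr p) * (ennreal D * N))"
    by (simp add: mult_left_mono)
  also have "\<dots> = ennreal (2 * (2 * C) powr (p - 1) * D * \<alpha> powr p) * N"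
    using D0 by (simp only: ennreal_mult mult_nonneg_nonneg powr_ge_zero zero_le_numeral ac_simps)
  finally show ?thesis .
qed

lemma small_part_A_infty:
  assumes c: "0 < c" and E: "\<And>S. S \<in> F \<Longrightarrow>
      (\<integral>\<^sup>+x\<in>S. ennreal (\<mu> x) \<partial>lebesgue) \<le> ennreal c * (\<integral>\<^sup>+x\<in>E S. ennreal (\<mu> x) \<partial>lebesgue)"
    and test: "\<And>S. S \<in> F \<Longrightarrow> ennreal (K S * V S ^ m) *
      ennpowr ((\<integral>\<^sup>+x\<in>S. ennreal (\<mu> x) \<partial>lebesgue) / ennreal (V S)) (1 / p) \<le> ennreal \<alpha>"
  shows "(\<integral>\<^sup>+x. ennreal (J x powr p) \<partial>M)
    \<le> ennreal (2 * (2 * (c * Carleson_const (p / (p - 1)))) powr (p - 1) * D * \<alpha> powr p) * N"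
proof -
  \<comment> \<open>The exponent dual to p: the q-th power of J^(p-1) is J^p, so the embedding
    returns the integral being estimated.\<close>
  define q where "q = p / (p - 1)"
  have q: "1 < q" "(p - 1) * q = p" "q * (1 - 1 / p) = 1"
    using p by (simp_all add: q_def field_simps)
  define g where "g = (\<lambda>x. J x powr (p - 1))"
  have [measurable]: "g \<in> borel_measurable lebesgue" and g0: "0 \<le> g x" for x
    by (simp_all add: g_def)
  have gq: "g x powr q = J x powr p" for x
    by (simp add: g_def powr_powr q)
  define T where "T = (\<lambda>S. avg M g S powr q * measure M S)"
  show ?thesis
    unfolding q_def[symmetric]
  proof (rule small_part[where T = T])
    show "0 < c * Carleson_const q"
      using c Carleson_const_pos[OF q(1)] by simp
    show "0 \<le> T S" for S by (simp add: T_def)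
    have "(\<Sum>S\<in>F. ennreal (T S)) = (\<Sum>S\<in>F. ennreal (avg M g S powr q) * emeasure M S)"
    proof (rule sum.cong)
      fix S assume S: "S \<in> F"
      show "ennreal (T S) = ennreal (avg M g S powr q) * emeasure M S"
        using emeasure_M_finite[OF S] by (simp add: T_def ennreal_mult emeasure_eq_ennreal_measure)
    qed simp
    also have "\<dots> \<le> ennreal c * ennreal ((2 * q / (q - 1)) powr q) * (\<integral>\<^sup>+x. ennreal (g x powr q) \<partial>M)"
    proof (rule Carleson_embedding[OF F(1) _ q(1)])
      show "laminar F"
        using F_dyadic by (intro laminar_dyadic) auto
      show "disjoint_family_on E F"
        using F by (auto simp: sparse_on_def)
      fix S assume S: "S \<in> F"
      show "S \<in> sets M" "emeasure M S < \<infinity>"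
        using F_sets[OF S] emeasure_M_finite[OF S] by auto
      have ES: "E S \<in> sets lebesgue" "E S \<subseteq> S"
        using F(2) S by (auto simp: sparse_on_def)
      then show "E S \<in> sets M" "E S \<subseteq> S" by auto
      show "emeasure M S \<le> ennreal c * emeasure M (E S)"
        using E[OF S] unfolding emeasure_M[OF F_sets[OF S]] emeasure_M[OF ES(1)] .
    qed (use g0 in auto)
    finally show "(\<Sum>S\<in>F. ennreal (T S)) \<le> ennreal (c * Carleson_const q) * (\<integral>\<^sup>+x. ennreal (J x powr p) \<partial>M)"
      using c by (simp add: gq Carleson_const_def ennreal_mult)
    fix S assume S: "S \<in> F"
    define \<mu>S where "\<mu>S = measure M S"
    have eS: "emeasure M S = ennreal \<mu>S" "0 \<le> \<mu>S"
      using emeasure_M_finite[OF S] by (auto simp: \<mu>S_def emeasure_eq_ennreal_measure)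
    have V: "0 < V S" by (rule V_pos[OF S])
    show "ennreal (K S * V S ^ m) * (\<integral>\<^sup>+x\<in>S. ennreal (J x powr (p - 1)) \<partial>M)
        \<le> ennreal (\<alpha> * V S powr (1 / p) * T S powr (1 - 1 / p))"
    proof (cases "\<mu>S = 0")
      case True
      then have "S \<in> null_sets M"
        using eS F_sets[OF S] by (auto simp: null_sets_def)
      then have "(\<integral>\<^sup>+x\<in>S. ennreal (J x powr (p - 1)) \<partial>M) = 0"
        by (rule nn_integral_null_set)
      then show ?thesis by simp
    next
      case False
      then have mS: "0 < \<mu>S" using eS by simp
      have "(\<integral>\<^sup>+x\<in>S. ennreal (g x) \<partial>M) \<le> (\<integral>\<^sup>+x. ennreal (g x) \<partial>M)"
        by (intro nn_integral_mono) (auto simp: indicator_def)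
      \<comment> \<open>Finiteness is essential here: for an infinite integral \<open>avg\<close>
        would be 0 and the next identity would fail.\<close>
      also have "\<dots> < \<infinity>"
        unfolding g_def using p by (intro J_powr_finite) simp
      finally have I: "(\<integral>\<^sup>+x\<in>S. ennreal (g x) \<partial>M) = ennreal (avg M g S * \<mu>S)"
        using mS by (simp add: avg_def \<mu>S_def)
      have "ennreal (K S * V S ^ m * (\<mu>S / V S) powr (1 / p)) \<le> ennreal \<alpha>"
        using test[OF S] K_nonneg[OF S] V eS unfolding emeasure_M[OF F_sets[OF S], symmetric]
        by (simp add: divide_ennreal ennreal_mult)
      then have "K S * V S ^ m * (\<mu>S / V S) powr (1 / p) \<le> \<alpha>"
        using \<alpha> by (simp add: ennreal_le_iff)
      then have t: "K S * V S ^ m * \<mu>S powr (1 / p) \<le> \<alpha> * V S powr (1 / p)"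
        using V eS by (simp add: powr_divide pos_divide_le_eq)
      \<comment> \<open>The mass is split as \<mu>S^(1/p) * \<mu>S^(1-1/p): the first factor is
        consumed by the testing bound, the second completes the average to T^(1-1/p).\<close>
      have "K S * V S ^ m * (avg M g S * \<mu>S)
          = (K S * V S ^ m * \<mu>S powr (1 / p)) * (avg M g S * \<mu>S powr (1 - 1 / p))"
        using mS by (simp add: powr_diff)
      also have "\<dots> \<le> (\<alpha> * V S powr (1 / p)) * (avg M g S * \<mu>S powr (1 - 1 / p))"
        using t by (rule mult_right_mono) simp
      also have "avg M g S * \<mu>S powr (1 - 1 / p) = T S powr (1 - 1 / p)"
        by (simp add: T_def powr_mult powr_powr q \<mu>S_def)
      finally have "ennreal (K S * V S ^ m * (avg M g S * \<mu>S)) \<le> ennreal (\<alpha> * V S powr (1 / p) * T S powr (1 - 1 / p))"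
        by (rule ennreal_leI)
      then show ?thesis
        using K_nonneg[OF S] I mS by (simp add: g_def ennreal_mult)
    qed
  qed
qed

text \<open>Hoelder's inequality on S with exponents v = r * p and its dual u isolates the integral
  of \<mu>^r. As v > p, the dual u is below p/(p-1), and q is the quotient of the two, u * q =
  p/(p-1) with q > 1. The Lebesgue embedding with exponent q, applied to h^u, therefore reproduces
  the integral of J^p against \<mu>.\<close>

lemma small_part_power_bump:
  assumes r: "1 < r"
    and test: "\<And>S. S \<in> F \<Longrightarrow> ennreal (K S * V S ^ m) *
      ennpowr ((\<integral>\<^sup>+x\<in>S. ennreal (\<mu> x powr r) \<partial>lebesgue) / ennreal (V S)) (1 / (r * p)) \<le> ennreal \<alpha>"
  shows "(\<integral>\<^sup>+x. ennreal (J x powr p) \<partial>M)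
    \<le> ennreal (2 * (2 * (2 * Carleson_const ((r * p - 1) / (r * (p - 1))))) powr (p - 1) * D * \<alpha> powr p) * N"
proof -
  define v where "v = r * p"
  define u where "u = v / (v - 1)"
  define q where "q = (r * p - 1) / (r * (p - 1))"
  have v: "p < v" using r p by (simp add: v_def)
  have uv: "1 < u" "1 < v" "1 / u + 1 / v = 1"
    using v p by (simp_all add: u_def field_simps)
  have rp: "0 < r * (p - 1)" using r p by simp
  have uq: "u * q = p / (p - 1)"
    using uv(2) r p by (simp add: u_def q_def v_def)
  have q: "1 < q"
    using rp r p by (simp add: q_def field_simps)
  have qp: "q * (1 - 1 / p) = 1 / u"
    using uq uv p by (simp add: field_simps)
  \<comment> \<open>Splits J^(p-1) * \<mu> as h * \<mu>^(1/p): the power p/(p-1) of h is J^p *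
    \<mu>, and the power v of the second factor is \<mu>^r.\<close>
  define h where "h = (\<lambda>x. J x powr (p - 1) * \<mu> x powr (1 - 1 / p))"
  have [measurable]: "h \<in> borel_measurable lebesgue"
    unfolding h_def by measurable
  have h0: "0 \<le> h x" for x by (simp add: h_def)
  have huq: "(h x powr u) powr q = J x powr p * \<mu> x" for x
  proof -
    have "(p - 1) * (p / (p - 1)) = p" "(1 - 1 / p) * (p / (p - 1)) = 1"
      using p by (simp_all add: field_simps)
    then have "h x powr (p / (p - 1)) = J x powr p * \<mu> x powr 1"
      unfolding h_def by (simp only: powr_mult powr_ge_zero powr_powr)
    then show ?thesis
      using mu_nonneg[of x] by (simp add: powr_powr uq)
  qed
  have int_h: "(\<integral>\<^sup>+x. ennreal ((h x powr u) powr q) \<partial>lebesgue) = (\<integral>\<^sup>+x. ennreal (J x powr p) \<partial>M)"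
    using mu_nonneg by (subst nn_integral_density) (auto simp: huq ennreal_mult mult.commute)
  define T where "T = (\<lambda>S. avg lebesgue (\<lambda>x. h x powr u) S powr q * V S)"
  show ?thesis
    unfolding q_def[symmetric]
  proof (rule small_part[where T = T])
    show "0 < 2 * Carleson_const q"
      using Carleson_const_pos[OF q] by simp
    show "0 \<le> T S" for S by (simp add: T_def)
    have "(\<Sum>S\<in>F. ennreal (T S)) \<le> ennreal (2 * Carleson_const q) *
        (\<integral>\<^sup>+x. ennreal ((h x powr u) powr q) \<partial>lebesgue)"
      unfolding T_def by (intro Carleson_sparse_lebesgue[OF F(1,2) q]) auto
    then show "(\<Sum>S\<in>F. ennreal (T S)) \<le> ennreal (2 * Carleson_const q) * (\<integral>\<^sup>+x. ennreal (J x powr p) \<partial>M)"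
      unfolding int_h .
    fix S assume S: "S \<in> F"
    note [measurable] = F_sets[OF S]
    have V: "0 < V S" by (rule V_pos[OF S])
    let ?a = "avg lebesgue (\<lambda>x. h x powr u) S"
    let ?R = "\<integral>\<^sup>+x\<in>S. ennreal (\<mu> x powr r) \<partial>lebesgue"
    show "ennreal (K S * V S ^ m) * (\<integral>\<^sup>+x\<in>S. ennreal (J x powr (p - 1)) \<partial>M)
        \<le> ennreal (\<alpha> * V S powr (1 / p) * T S powr (1 - 1 / p))"
    \<comment> \<open>When K vanishes the testing bound says nothing about the integral of \<mu>^r,
      which may be infinite; otherwise it forces finiteness.\<close>
    proof (cases "K S = 0")
      case True
      then show ?thesis using \<alpha> by simp
    next
      case False
      then have KV: "0 < K S * V S ^ m" using K_nonneg[OF S] V by simp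
      have "?R \<noteq> top"
      proof
        assume "?R = top"
        then show False
          using test[OF S] KV V False by (simp add: ennreal_top_divide ennreal_mult_top top_unique)
      qed
      then obtain \<rho> where \<rho>: "?R = ennreal \<rho>" "0 \<le> \<rho>" by (cases ?R) auto
      have "ennreal (K S * V S ^ m * (\<rho> / V S) powr (1 / v)) \<le> ennreal \<alpha>"
        using test[OF S] KV V \<rho> by (simp add: divide_ennreal ennreal_mult v_def)
      then have "K S * V S ^ m * (\<rho> / V S) powr (1 / v) \<le> \<alpha>"
        using \<alpha> by (simp add: ennreal_le_iff)
      then have t: "K S * V S ^ m * \<rho> powr (1 / v) \<le> \<alpha> * V S powr (1 / v)"
        using V \<rho> by (simp add: powr_divide pos_divide_le_eq)
      have "(\<integral>\<^sup>+x\<in>S. ennreal (h x powr u) \<partial>lebesgue)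
          \<le> (\<integral>\<^sup>+x. indicator S x + ennreal ((h x powr u) powr q) \<partial>lebesgue)"
      proof (rule nn_integral_mono)
        fix x
        \<comment> \<open>Local finiteness of the integral of h^u, so that \<open>avg\<close> is its
          true average: the larger power h^(uq) has a finite integral and S has finite
          measure.\<close>
        have "h x powr u \<le> 1 + (h x powr u) powr q"
        proof (cases "h x powr u \<le> 1")
          case False
          then have "(h x powr u) powr 1 \<le> (h x powr u) powr q"
            using q by (intro powr_mono) auto
          then show ?thesis by simp
        qed (simp add: add_increasing2)
        then have "ennreal (h x powr u) \<le> ennreal (1 + (h x powr u) powr q)"
          by (rule ennreal_leI)
        then show "ennreal (h x powr u) * indicator S x \<le> indicator S x + ennreal ((h x powr u) powr q)"
          by (cases "x \<in> S") simp_all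
      qed
      also have "\<dots> = emeasure lebesgue S + (\<integral>\<^sup>+x. ennreal (J x powr p) \<partial>M)"
        by (subst nn_integral_add) (simp_all add: int_h del: emeasure_completion)
      also have "\<dots> < \<infinity>"
        using J_powr_finite[of p] p emeasure_dyadic[OF F_dyadic[OF S]] by simp
      finally have H: "(\<integral>\<^sup>+x\<in>S. ennreal (h x powr u) \<partial>lebesgue) = ennreal (?a * V S)"
        by (intro nn_integral_eq_avg F_dyadic[OF S])
      have "(\<integral>\<^sup>+x\<in>S. ennreal (J x powr (p - 1)) \<partial>M)
          = (\<integral>\<^sup>+x. (ennreal (h x) * indicator S x) * (ennreal (\<mu> x powr (1 / p)) * indicator S x) \<partial>lebesgue)"
      proof (subst nn_integral_density)
        have "\<mu> x powr (1 - 1 / p) * \<mu> x powr (1 / p) = \<mu> x" for x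
          using mu_nonneg[of x] by (simp flip: powr_add)
        then have "J x powr (p - 1) * \<mu> x = h x * \<mu> x powr (1 / p)" for x
          by (simp add: h_def mult.assoc)
        then have "ennreal (\<mu> x) * ennreal (J x powr (p - 1)) = ennreal (h x) * ennreal (\<mu> x powr (1 / p))" for x
          using mu_nonneg[of x] h0[of x] by (simp add: mult.commute flip: ennreal_mult)
        then show "(\<integral>\<^sup>+x. ennreal (\<mu> x) * (ennreal (J x powr (p - 1)) * indicator S x) \<partial>lebesgue)
          = (\<integral>\<^sup>+x. (ennreal (h x) * indicator S x) * (ennreal (\<mu> x powr (1 / p)) * indicator S x) \<partial>lebesgue)"
          by (intro nn_integral_cong) (auto simp: indicator_def)
      qed auto
      also have "\<dots> \<le> ennpowr (\<integral>\<^sup>+x. ennpowr (ennreal (h x) * indicator S x) u \<partial>lebesgue) (1 / u) *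
          ennpowr (\<integral>\<^sup>+x. ennpowr (ennreal (\<mu> x powr (1 / p)) * indicator S x) v \<partial>lebesgue) (1 / v)"
        by (intro Holder_nn_integral uv) auto
      also have "(\<integral>\<^sup>+x. ennpowr (ennreal (h x) * indicator S x) u \<partial>lebesgue)
          = (\<integral>\<^sup>+x\<in>S. ennreal (h x powr u) \<partial>lebesgue)"
        using h0 by (intro nn_integral_cong) (auto simp: indicator_def)
      also have "(\<integral>\<^sup>+x. ennpowr (ennreal (\<mu> x powr (1 / p)) * indicator S x) v \<partial>lebesgue) = ?R"
        using p(1) by (intro nn_integral_cong) (auto simp: indicator_def powr_powr v_def)
      finally have I: "(\<integral>\<^sup>+x\<in>S. ennreal (J x powr (p - 1)) \<partial>M)
          \<le> ennreal ((?a * V S) powr (1 / u) * \<rho> powr (1 / v))"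
        using V \<rho> unfolding H \<rho>(1) by (simp flip: ennreal_mult)
      have "K S * V S ^ m * ((?a * V S) powr (1 / u) * \<rho> powr (1 / v))
          = (K S * V S ^ m * \<rho> powr (1 / v)) * (?a * V S) powr (1 / u)"
        by simp
      also have "\<dots> \<le> (\<alpha> * V S powr (1 / v)) * (?a * V S) powr (1 / u)"
        using t by (rule mult_right_mono) simp
      also have "\<dots> = \<alpha> * (V S powr (1 / u + 1 / v)) * ?a powr (1 / u)"
        using V by (simp only: powr_mult powr_add less_imp_le avg_nonneg ac_simps)
      \<comment> \<open>The Hoelder exponents combine to the first power of |S|, which is split
        again: |S|^(1/p) belongs to \<open>b\<close>, the rest to \<open>T\<close>.\<close>
      also have "V S powr (1 / u + 1 / v) = V S powr (1 / p) * V S powr (1 - 1 / p)"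
        using V by (simp add: uv flip: powr_add)
      also have "\<alpha> * (V S powr (1 / p) * V S powr (1 - 1 / p)) * ?a powr (1 / u)
          = \<alpha> * V S powr (1 / p) * T S powr (1 - 1 / p)"
        using V by (simp add: T_def powr_mult powr_powr qp)
      finally have "ennreal (K S * V S ^ m * ((?a * V S) powr (1 / u) * \<rho> powr (1 / v)))
          \<le> ennreal (\<alpha> * V S powr (1 / p) * T S powr (1 - 1 / p))"
        by (rule ennreal_leI)
      moreover have "ennreal (K S * V S ^ m) * (\<integral>\<^sup>+x\<in>S. ennreal (J x powr (p - 1)) \<partial>M)
          \<le> ennreal (K S * V S ^ m) * ennreal ((?a * V S) powr (1 / u) * \<rho> powr (1 / v))"
        using I by (rule mult_left_mono) simp
      ultimately show ?thesis
        using KV by (simp add: ennreal_mult)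
    qed
  qed
qed

end

section \<open>From dyadic cubes to Morrey norms\<close>

lemma powr_minus_divide_mult:
  fixes V :: real
  assumes "0 < V"
  shows "(V powr (- 1 / a)) powr p * V = V powr (1 - p / a)"
  using assms powr_add[of V "- p / a" 1] by (simp add: powr_powr)

text \<open>Hoelder's inequality against the indicator of S. Besides the large cubes, it serves to
  deduce the plain testing bound from the power bump.\<close>

lemma Jensen_dyadic:
  assumes S: "S \<in> dyadic_grid" and q: "1 < q"
    and g [measurable]: "g \<in> borel_measurable lebesgue" and g0: "\<And>x. 0 \<le> g x"
  shows "(\<integral>\<^sup>+x\<in>S. ennreal (g x) \<partial>lebesgue) \<le> ennreal (measure lebesgue S) *
    ennpowr ((\<integral>\<^sup>+x\<in>S. ennreal (g x powr q) \<partial>lebesgue) / ennreal (measure lebesgue S)) (1 / q)"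
proof -
  let ?V = "measure lebesgue S" and ?I = "\<integral>\<^sup>+x\<in>S. ennreal (g x powr q) \<partial>lebesgue"
  note [measurable] = sets_dyadic[OF S]
  have V: "0 < ?V" by (rule measure_dyadic_pos[OF S])
  define v where "v = q / (q - 1)"
  have v: "1 < v" "1 / q + 1 / v = 1" "1 / v = 1 - 1 / q"
    using q by (simp_all add: v_def field_simps)
  have "(\<integral>\<^sup>+x\<in>S. ennreal (g x) \<partial>lebesgue)
      = (\<integral>\<^sup>+x. (ennreal (g x) * indicator S x) * indicator S x \<partial>lebesgue)"
    by (intro nn_integral_cong) (auto simp: indicator_def)
  also have "\<dots> \<le> ennpowr (\<integral>\<^sup>+x. ennpowr (ennreal (g x) * indicator S x) q \<partial>lebesgue) (1 / q)
      * ennpowr (\<integral>\<^sup>+x. ennpowr (indicator S x) v \<partial>lebesgue) (1 / v)"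
    by (intro Holder_nn_integral q v) auto
  also have "(\<integral>\<^sup>+x. ennpowr (ennreal (g x) * indicator S x) q \<partial>lebesgue) = ?I"
    using g0 by (intro nn_integral_cong) (auto simp: indicator_def)
  also have "(\<integral>\<^sup>+x. ennpowr (indicator S x) v \<partial>lebesgue) = (\<integral>\<^sup>+x. indicator S x \<partial>lebesgue)"
    by (intro nn_integral_cong) (auto simp: indicator_def simp flip: ennreal_1)
  also have "\<dots> = ennreal ?V"
    using emeasure_dyadic[OF S] by simp
  also have "ennpowr ?I (1 / q) = ennpowr (?I / ennreal ?V * ennreal ?V) (1 / q)"
    using V by (simp add: ennreal_divide_times ennreal_times_divide ennreal_mult_divide_eq)
  also have "\<dots> = ennpowr (?I / ennreal ?V) (1 / q) * ennreal (?V powr (1 / q))"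
    by (simp add: ennpowr_mult)
  finally have "(\<integral>\<^sup>+x\<in>S. ennreal (g x) \<partial>lebesgue)
      \<le> ennpowr (?I / ennreal ?V) (1 / q) * (ennreal (?V powr (1 / q)) * ennreal (?V powr (1 / v)))"
    by (simp add: mult.assoc)
  also have "ennreal (?V powr (1 / q)) * ennreal (?V powr (1 / v)) = ennreal ?V"
    using V by (simp add: v(2) flip: ennreal_mult powr_add)
  finally show ?thesis by (simp add: mult.commute)
qed

lemma prod_morrey_norm_dyadic:
  assumes S: "S \<in> dyadic_grid" and f: "\<And>i x. i < m \<Longrightarrow> 0 \<le> f i x" and P: "\<And>i. i < m \<Longrightarrow> 1 < P i"
  shows "(\<Prod>i<m. ennpowr ((\<integral>\<^sup>+x\<in>S. ennreal (f i x powr P i) \<partial>lebesgue) / ennreal (measure lebesgue S)) (1 / P i))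
    \<le> ennreal (measure lebesgue S powr (- 1 / p0)) * prod_morrey_norm m P p0 f"
    (is "?L \<le> _")
proof -
  let ?V = "measure lebesgue S"
  have V: "0 < ?V" by (rule measure_dyadic_pos[OF S])
  obtain R where R: "R \<in> cubes" "S \<subseteq> R" "measure lebesgue R = ?V"
    using dyadic_grid_in_cube[OF S] .
  let ?R = "\<Prod>i<m. ennpowr ((\<integral>\<^sup>+x\<in>R. ennreal (\<bar>f i x\<bar> powr P i) \<partial>lebesgue) / ennreal ?V) (1 / P i)"
  have "?L \<le> ?R"
  proof (rule prod_mono_ennreal)
    fix i assume "i \<in> {..<m}"
    then have i: "i < m" by simp
    have "(\<integral>\<^sup>+x\<in>S. ennreal (f i x powr P i) \<partial>lebesgue) \<le> (\<integral>\<^sup>+x\<in>R. ennreal (\<bar>f i x\<bar> powr P i) \<partial>lebesgue)"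
      using R(2) f[OF i] by (intro nn_integral_mono) (auto simp: indicator_def)
    then show "ennpowr ((\<integral>\<^sup>+x\<in>S. ennreal (f i x powr P i) \<partial>lebesgue) / ennreal ?V) (1 / P i)
        \<le> ennpowr ((\<integral>\<^sup>+x\<in>R. ennreal (\<bar>f i x\<bar> powr P i) \<partial>lebesgue) / ennreal ?V) (1 / P i)"
      using P[OF i] by (intro ennpowr_mono divide_right_mono_ennreal) auto
  qed
  also have "?R = ennreal (?V powr (- 1 / p0)) * (ennreal (?V powr (1 / p0)) * ?R)"
    using V by (simp add: mult.assoc[symmetric] powr_add[symmetric] ennreal_mult[symmetric])
  also have "ennreal (?V powr (1 / p0)) * ?R \<le> prod_morrey_norm m P p0 f"
    unfolding prod_morrey_norm_def R(3)[symmetric] by (rule SUP_upper[OF R(1)])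
  finally show ?thesis by (simp add: mult_left_mono)
qed

text \<open>The origin of the exponent in the summation condition: Jensen contributes |S| for each
  of the m factors, the Morrey norm contributes |S|^(-1/p0).\<close>

lemma prod_nn_integral_le_morrey:
  assumes S: "S \<in> dyadic_grid" and P: "\<And>i. i < m \<Longrightarrow> 1 < P i"
    and f: "\<And>i. i < m \<Longrightarrow> f i \<in> borel_measurable lebesgue" "\<And>i x. i < m \<Longrightarrow> 0 \<le> f i x"
  shows "(\<Prod>i<m. \<integral>\<^sup>+x\<in>S. ennreal (f i x) \<partial>lebesgue)
    \<le> ennreal (measure lebesgue S powr (real m - 1 / p0)) * prod_morrey_norm m P p0 f"
proof -
  let ?V = "measure lebesgue S"
  have V: "0 < ?V" by (rule measure_dyadic_pos[OF S])
  have "(\<Prod>i<m. \<integral>\<^sup>+x\<in>S. ennreal (f i x) \<partial>lebesgue) \<le> (\<Prod>i<m. ennreal ?V *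
      ennpowr ((\<integral>\<^sup>+x\<in>S. ennreal (f i x powr P i) \<partial>lebesgue) / ennreal ?V) (1 / P i))"
    using f P by (intro prod_mono_ennreal Jensen_dyadic[OF S]) auto
  also have "\<dots> = ennreal (?V ^ m) *
      (\<Prod>i<m. ennpowr ((\<integral>\<^sup>+x\<in>S. ennreal (f i x powr P i) \<partial>lebesgue) / ennreal ?V) (1 / P i))"
    by (simp add: prod.distrib ennreal_power)
  also have "\<dots> \<le> ennreal (?V ^ m) * (ennreal (?V powr (- 1 / p0)) * prod_morrey_norm m P p0 f)"
    by (intro mult_left_mono prod_morrey_norm_dyadic S f P) auto
  also have "\<dots> = ennreal (?V powr (real m - 1 / p0)) * prod_morrey_norm m P p0 f"
    using V by (simp add: mult.assoc[symmetric] ennreal_mult[symmetric] powr_realpow[symmetric]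
        powr_add[symmetric])
  finally show ?thesis .
qed

text \<open>The cubes inside \<open>Q\<close> are summed through finite subfamilies; those strictly containing \<open>Q\<close>
  contribute a constant on \<open>Q\<close>, which the summation condition on \<open>K\<close> reduces to a single term.\<close>

lemma sparse_op_dyadic_bound:
  fixes \<mu> :: "real^'n::finite \<Rightarrow> real" and P :: "nat \<Rightarrow> real"
  assumes mu: "weight \<mu>" and K: "\<And>Q. Q \<in> dyadic_grid \<Longrightarrow> 0 \<le> K Q"
    and S: "\<S> \<subseteq> dyadic_grid"
    and P: "\<And>i. i < m \<Longrightarrow> 1 < P i" and p: "1 / p = (\<Sum>i<m. 1 / P i)" "1 < p"
    and CD: "0 \<le> CD" "\<And>Q. Q \<in> dyadic_grid \<Longrightarrow>
           (\<Sum>\<^sub>\<infinity>Q'\<in>{Q'\<in>dyadic_grid. Q \<subset> Q'}. ennreal (K Q' * measure lebesgue Q' powr (real m - 1/p0)))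
           \<le> ennreal (CD * K Q * measure lebesgue Q powr (real m - 1/p0))"
    and \<alpha>: "0 \<le> \<alpha>" and test: "\<And>Q. Q \<in> dyadic_grid \<Longrightarrow> ennreal (K Q * measure lebesgue Q ^ m) *
        ennpowr ((\<integral>\<^sup>+x\<in>Q. ennreal (\<mu> x) \<partial>lebesgue) / ennreal (measure lebesgue Q)) (1/p) \<le> ennreal \<alpha>"
    and f: "\<And>i. i < m \<Longrightarrow> locally_integrable (f i)" "\<And>i x. i < m \<Longrightarrow> 0 \<le> f i x"
    and Q: "Q \<in> dyadic_grid"
    and C1: "0 \<le> C1" and small: "\<And>F. finite F \<Longrightarrow> F \<subseteq> \<S> \<Longrightarrow> (\<And>S. S \<in> F \<Longrightarrow> S \<subseteq> Q) \<Longrightarrow>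
        (\<integral>\<^sup>+x. ennreal (sparse_sum K F m f x powr p) \<partial>density lebesgue (\<lambda>x. ennreal (\<mu> x)))
        \<le> ennreal (C1 * \<alpha> powr p) *
          (\<Prod>i<m. ennpowr (\<integral>\<^sup>+x\<in>Q. ennreal (f i x powr P i) \<partial>lebesgue) (p / P i))"
  shows "\<exists>H\<in>borel_measurable lebesgue. (\<forall>x\<in>Q. ennpowr (sparse_op K \<S> m f x) p * ennreal (\<mu> x) \<le> H x) \<and>
    (\<integral>\<^sup>+x\<in>Q. H x \<partial>lebesgue) \<le> ennreal (2 powr p * (C1 + CD powr p) * measure lebesgue Q powr (1 - p / p0)) *
      ennpowr (ennreal \<alpha> * prod_morrey_norm m P p0 f) p"
proof -
  let ?V = "measure lebesgue"
  let ?M = "density lebesgue (\<lambda>x. ennreal (\<mu> x))"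
  define B where "B = prod_morrey_norm m P p0 f"
  have V: "0 < ?V Q" by (rule measure_dyadic_pos[OF Q])
  have mu': "\<mu> \<in> borel_measurable lebesgue" "0 \<le> \<mu> x" for x
    using mu by (auto simp: weight_def locally_integrable_def)
  have fm: "f i \<in> borel_measurable lebesgue" if "i < m" for i
    using f(1)[OF that] by (simp add: locally_integrable_def)
  note [measurable] = mu'(1) sets_dyadic[OF Q]
  define a where "a = (\<lambda>S x. ennreal (K S) * (\<Prod>i<m. \<integral>\<^sup>+y\<in>S. ennreal (f i y) \<partial>lebesgue) * indicator S x)"
  define L where "L = ennreal (CD * K Q * ?V Q powr (real m - 1 / p0)) * B"
  define \<T> where "\<T> = {S \<in> \<S>. S \<subseteq> Q}"
  have "countable \<T>"
    by (rule countable_subset[OF _ countable_dyadic_grid]) (use S in \<open>auto simp: \<T>_def\<close>)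
  \<comment> \<open>An increasing exhaustion of the countable family \<T> by finite sets, as
    monotone convergence requires.\<close>
  define A where "A = (\<lambda>n::nat. {S \<in> \<T>. to_nat_on \<T> S \<le> n})"
  have finA: "finite (A n)" for n
  proof (rule finite_imageD)
    show "finite (to_nat_on \<T> ` A n)"
      by (rule finite_subset[of _ "{..n}"]) (auto simp: A_def)
    show "inj_on (to_nat_on \<T>) (A n)"
      using inj_on_to_nat_on[OF \<open>countable \<T>\<close>] by (rule inj_on_subset) (auto simp: A_def)
  qed
  have A_sub: "A n \<subseteq> \<S>" "\<And>S. S \<in> A n \<Longrightarrow> S \<subseteq> Q" for n
    by (auto simp: A_def \<T>_def)
  have K_A: "0 \<le> K S" if "S \<in> A n" for S n
    using K A_sub(1)[of n] S that by auto
  define u where "u = (\<lambda>n x. ennreal (sparse_sum K (A n) m f x))"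
  \<comment> \<open>Local integrability makes every integral of \<open>f i\<close> over a dyadic
    cube finite, so the real averages lose nothing.\<close>
  have u_eq: "u n x = (\<Sum>S\<in>A n. a S x)" for n x
  proof -
    have "u n x = (\<Sum>S\<in>A n. ennreal ((K S * ?V S ^ m * (\<Prod>i<m. avg lebesgue (f i) S)) * indicator S x))"
      unfolding u_def sparse_sum_def using K_A
      by (intro sum_ennreal[symmetric] mult_nonneg_nonneg prod_nonneg) auto
    also have "\<dots> = (\<Sum>S\<in>A n. a S x)"
    proof (rule sum.cong)
      fix T assume "T \<in> A n"
      then have T: "T \<in> dyadic_grid" using A_sub S by blast
      have "(\<Prod>i<m. \<integral>\<^sup>+y\<in>T. ennreal (f i y) \<partial>lebesgue) = (\<Prod>i<m. ennreal (avg lebesgue (f i) T * ?V T))"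
        using f T by (intro prod.cong nn_integral_eq_avg locally_integrable_nn_integral) auto
      also have "\<dots> = ennreal (?V T ^ m * (\<Prod>i<m. avg lebesgue (f i) T))"
        by (subst prod_ennreal) (auto simp: prod.distrib mult.commute)
      finally have "a T x = ennreal (K T) * ennreal (?V T ^ m * (\<Prod>i<m. avg lebesgue (f i) T)) * indicator T x"
        by (simp add: a_def)
      also have "\<dots> = ennreal ((K T * ?V T ^ m * (\<Prod>i<m. avg lebesgue (f i) T)) * indicator T x)"
        using K[OF T] by (cases "x \<in> T") (simp_all add: ennreal_mult prod_nonneg mult.assoc)
      finally show "ennreal ((K T * ?V T ^ m * (\<Prod>i<m. avg lebesgue (f i) T)) * indicator T x) = a T x" ..
    qed simp
    finally show ?thesis .
  qed
  have [measurable]: "u n \<in> borel_measurable lebesgue" for n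
  proof -
    have "sparse_sum K (A n) m f \<in> borel_measurable lebesgue"
      unfolding sparse_sum_def[abs_def] using A_sub(1)[of n] S sets_dyadic
      by (intro borel_measurable_sum borel_measurable_times borel_measurable_const borel_measurable_indicator) blast
    then show ?thesis unfolding u_def by simp
  qed
  have u_mono: "u n x \<le> u k x" if "n \<le> k" for n k x
    unfolding u_eq using that by (intro sum_mono2 finA) (auto simp: A_def)
  define U where "U = (\<lambda>x. SUP n. u n x)"
  have [measurable]: "U \<in> borel_measurable lebesgue"
    unfolding U_def by measurable
  have point: "sparse_op K \<S> m f x \<le> U x + L" if x: "x \<in> Q" for x
  proof -
    \<comment> \<open>The infinite sum is the supremum over finite subfamilies, so it suffices to
      bound each of these uniformly.\<close>
    have "(\<Sum>S\<in>G. a S x) \<le> U x + L" if G: "finite G" "G \<subseteq> \<S>" for G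
    proof -
      define G1 where "G1 = G \<inter> \<T>"
      define G2 where "G2 = {S \<in> G. Q \<subset> S}"
      have "(\<Sum>S\<in>G. a S x) = (\<Sum>S\<in>G1 \<union> G2. a S x)"
      proof (rule sum.mono_neutral_right)
        \<comment> \<open>A cube that neither lies in \<open>Q\<close> nor contains it is disjoint
          from \<open>Q\<close> by nestedness, hence misses x.\<close>
        show "\<forall>S\<in>G - (G1 \<union> G2). a S x = 0"
        proof
          fix T assume T: "T \<in> G - (G1 \<union> G2)"
          then have "T \<in> dyadic_grid" "\<not> T \<subseteq> Q" "\<not> Q \<subseteq> T"
            using G S by (auto simp: G1_def G2_def \<T>_def)
          then have "x \<notin> T"
            using dyadic_grid_nested[of T Q] Q x by auto
          then show "a T x = 0" by (simp add: a_def)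
        qed
      qed (use G in \<open>auto simp: G1_def G2_def\<close>)
      also have "\<dots> = (\<Sum>S\<in>G1. a S x) + (\<Sum>S\<in>G2. a S x)"
        using G by (intro sum.union_disjoint) (auto simp: G1_def G2_def \<T>_def)
      also have "(\<Sum>S\<in>G1. a S x) \<le> U x"
      proof -
        define n where "n = Max (insert 0 (to_nat_on \<T> ` G1))"
        have "G1 \<subseteq> A n"
          using G by (auto simp: A_def n_def G1_def intro!: Max_ge)
        then have "(\<Sum>S\<in>G1. a S x) \<le> u n x"
          unfolding u_eq by (intro sum_mono2 finA) auto
        also have "\<dots> \<le> U x"
          unfolding U_def by (rule SUP_upper) simp
        finally show ?thesis .
      qed
      also have "(\<Sum>S\<in>G2. a S x) \<le> L"
      proof -
        have G2: "finite G2" "G2 \<subseteq> {Q' \<in> dyadic_grid. Q \<subset> Q'}"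
          using G S by (auto simp: G2_def)
        have "(\<Sum>S\<in>G2. a S x) \<le> (\<Sum>S\<in>G2. ennreal (K S * ?V S powr (real m - 1 / p0)) * B)"
        proof (rule sum_mono)
          fix T assume "T \<in> G2"
          then have T: "T \<in> dyadic_grid" using G2 by auto
          have "a T x \<le> ennreal (K T) * (\<Prod>i<m. \<integral>\<^sup>+y\<in>T. ennreal (f i y) \<partial>lebesgue)"
            by (simp add: a_def indicator_def)
          also have "\<dots> \<le> ennreal (K T) * (ennreal (?V T powr (real m - 1 / p0)) * B)"
            unfolding B_def using fm f(2)
            by (intro mult_left_mono prod_nn_integral_le_morrey[where P = P] T P) auto
          also have "\<dots> = ennreal (K T * ?V T powr (real m - 1 / p0)) * B"
            using K[OF T] by (simp add: ennreal_mult mult.assoc)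
          finally show "a T x \<le> \<dots>" .
        qed
        also have "\<dots> = (\<Sum>S\<in>G2. ennreal (K S * ?V S powr (real m - 1 / p0))) * B"
          by (rule sum_distrib_right[symmetric])
        also have "(\<Sum>S\<in>G2. ennreal (K S * ?V S powr (real m - 1 / p0))) \<le>
            (\<Sum>\<^sub>\<infinity>Q'\<in>{Q'\<in>dyadic_grid. Q \<subset> Q'}. ennreal (K Q' * ?V Q' powr (real m - 1/p0)))"
          using G2 by (subst nonneg_infsum_complete) (auto intro!: SUP_upper)
        also have "\<dots> \<le> ennreal (CD * K Q * ?V Q powr (real m - 1/p0))"
          by (rule CD(2)[OF Q])
        finally show ?thesis unfolding L_def by (simp add: mult_right_mono)
      qed
      finally show ?thesis by (simp add: add_mono)
    qed
    then have "(\<Sum>\<^sub>\<infinity>S\<in>\<S>. a S x) \<le> U x + L"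
      by (subst nonneg_infsum_complete) (auto intro!: SUP_least)
    then show ?thesis
      unfolding sparse_op_def a_def .
  qed
  \<comment> \<open>A measurable majorant: additivity of the integral is used only for functions
    built from \<open>U\<close> and \<open>L\<close>, and later for these majorants over several
    cubes.\<close>
  define H where "H = (\<lambda>x. ennreal (2 powr p) * (ennpowr (U x) p + ennpowr L p) * ennreal (\<mu> x))"
  have HU: "(\<integral>\<^sup>+x\<in>Q. ennpowr (U x) p * ennreal (\<mu> x) \<partial>lebesgue)
      \<le> ennreal (C1 * ?V Q powr (1 - p / p0)) * ennpowr (ennreal \<alpha> * B) p"
  proof -
    let ?N = "\<Prod>i<m. ennpowr (\<integral>\<^sup>+x\<in>Q. ennreal (f i x powr P i) \<partial>lebesgue) (p / P i)"
    have "(\<integral>\<^sup>+x\<in>Q. ennpowr (U x) p * ennreal (\<mu> x) \<partial>lebesgue)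
        \<le> (\<integral>\<^sup>+x. ennreal (\<mu> x) * ennpowr (U x) p \<partial>lebesgue)"
      by (intro nn_integral_mono) (auto simp: indicator_def mult.commute)
    also have "\<dots> = (\<integral>\<^sup>+x. ennpowr (U x) p \<partial>?M)"
      by (intro nn_integral_density[symmetric]) auto
    also have "\<dots> = (\<integral>\<^sup>+x. (SUP n. ennpowr (u n x) p) \<partial>?M)"
      using p by (simp add: U_def ennpowr_SUP)
    also have "\<dots> = (SUP n. \<integral>\<^sup>+x. ennpowr (u n x) p \<partial>?M)"
      using p u_mono by (intro nn_integral_monotone_convergence_SUP)
        (auto simp: incseq_def le_fun_def intro!: ennpowr_mono)
    also have "\<dots> \<le> ennreal (C1 * \<alpha> powr p) * ?N"
    proof (rule SUP_least)
      fix n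
      have "0 \<le> sparse_sum K (A n) m f x" for x
        unfolding sparse_sum_def using K_A
        by (intro sum_nonneg mult_nonneg_nonneg prod_nonneg) auto
      then show "(\<integral>\<^sup>+x. ennpowr (u n x) p \<partial>?M) \<le> ennreal (C1 * \<alpha> powr p) * ?N"
        using small[OF finA A_sub] by (simp add: u_def)
    qed
    also have "?N \<le> ennreal (?V Q powr (1 - p / p0)) * ennpowr B p"
    proof -
      let ?I = "\<lambda>i. \<integral>\<^sup>+x\<in>Q. ennreal (f i x powr P i) \<partial>lebesgue"
      \<comment> \<open>Thus turning the m integrals into averages over \<open>Q\<close> releases
        exactly one factor |Q|; with the factor |Q|^(-p/p0) from the Morrey norm it gives the power
        1 - p/p0.\<close>
      have sum1: "(\<Sum>i<m. p / P i) = 1"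
      proof -
        have "(\<Sum>i<m. p / P i) = p * (\<Sum>i<m. 1 / P i)"
          by (simp add: sum_distrib_left)
        then show ?thesis using p(2) by (simp flip: p(1))
      qed
      have "?N = (\<Prod>i<m. ennpowr (ennpowr (?I i / ennreal (?V Q)) (1 / P i)) p * ennreal (?V Q powr (p / P i)))"
      proof (rule prod.cong)
        fix i
        have "ennpowr (?I i) (p / P i) = ennpowr (?I i / ennreal (?V Q) * ennreal (?V Q)) (p / P i)"
          using V by (simp add: ennreal_divide_times ennreal_times_divide ennreal_mult_divide_eq)
        then show "ennpowr (?I i) (p / P i)
            = ennpowr (ennpowr (?I i / ennreal (?V Q)) (1 / P i)) p * ennreal (?V Q powr (p / P i))"
          by (simp add: ennpowr_mult ennpowr_ennpowr)
      qed simp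
      also have "\<dots> = ennpowr (\<Prod>i<m. ennpowr (?I i / ennreal (?V Q)) (1 / P i)) p * ennreal (?V Q)"
      proof -
        have "(\<Prod>i<m. ennreal (?V Q powr (p / P i))) = ennreal (?V Q powr (\<Sum>i<m. p / P i))"
          using V by (subst prod_ennreal) (auto simp: powr_sum)
        then show ?thesis using V by (simp add: prod.distrib ennpowr_prod sum1)
      qed
      also have "\<dots> \<le> ennpowr (ennreal (?V Q powr (- 1 / p0)) * B) p * ennreal (?V Q)"
        unfolding B_def using p(2)
        by (intro mult_right_mono ennpowr_mono prod_morrey_norm_dyadic Q f P) auto
      also have "\<dots> = ennreal (?V Q powr (1 - p / p0)) * ennpowr B p"
        unfolding powr_minus_divide_mult[OF V, symmetric]
        by (simp add: ennpowr_mult ennreal_mult ac_simps)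
      finally show ?thesis .
    qed
    finally have "(\<integral>\<^sup>+x\<in>Q. ennpowr (U x) p * ennreal (\<mu> x) \<partial>lebesgue)
        \<le> ennreal (C1 * \<alpha> powr p) * (ennreal (?V Q powr (1 - p / p0)) * ennpowr B p)"
      by (simp add: mult_left_mono)
    also have "\<dots> = ennreal (C1 * ?V Q powr (1 - p / p0)) * (ennreal (\<alpha> powr p) * ennpowr B p)"
      using C1 by (simp only: ennreal_mult powr_ge_zero ac_simps)
    finally show ?thesis using \<alpha> by (simp add: ennpowr_mult)
  qed
  have HL: "(\<integral>\<^sup>+x\<in>Q. ennpowr L p * ennreal (\<mu> x) \<partial>lebesgue)
      \<le> ennreal (CD powr p * ?V Q powr (1 - p / p0)) * ennpowr (ennreal \<alpha> * B) p"
  proof -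
    let ?w = "\<integral>\<^sup>+x\<in>Q. ennreal (\<mu> x) \<partial>lebesgue"
    let ?k = "K Q * ?V Q ^ m"
    have k: "0 \<le> ?k" using K[OF Q] by simp
    have "CD * K Q * ?V Q powr (real m - 1 / p0) = CD * ?V Q powr (- 1 / p0) * ?k"
      using V by (simp add: powr_diff powr_minus_divide powr_realpow)
    then have L: "L = ennreal (CD * ?V Q powr (- 1 / p0)) * ennreal ?k * B"
      using CD(1) k unfolding L_def by (simp only: ennreal_mult mult_nonneg_nonneg powr_ge_zero)
    \<comment> \<open>Writes the mass of \<open>Q\<close> as |Q| times the p-th power of the factor
      in the testing condition. The other factor K(Q) * |Q|^m has just been separated in L, so
      testing on \<open>Q\<close> itself bounds their product.\<close>
    have w: "?w = ennpowr (ennpowr (?w / ennreal (?V Q)) (1 / p)) p * ennreal (?V Q)"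
      using V p(2) by (simp add: ennpowr_ennpowr ennreal_divide_times ennreal_times_divide ennreal_mult_divide_eq)
    have "(\<integral>\<^sup>+x\<in>Q. ennpowr L p * ennreal (\<mu> x) \<partial>lebesgue) = ennpowr L p * ?w"
      by (simp add: mult.assoc nn_integral_cmult)
    also have "\<dots> = ennreal ((CD * ?V Q powr (- 1 / p0)) powr p) * ennreal (?V Q) *
        (ennpowr (ennreal ?k * ennpowr (?w / ennreal (?V Q)) (1 / p)) p * ennpowr B p)"
      using CD(1) by (subst w) (simp only: L ennpowr_mult ennpowr_ennreal mult_nonneg_nonneg powr_ge_zero ac_simps)
    also have "\<dots> \<le> ennreal ((CD * ?V Q powr (- 1 / p0)) powr p) * ennreal (?V Q) *
        (ennpowr (ennreal \<alpha>) p * ennpowr B p)"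
      using p(2) by (intro mult_left_mono mult_right_mono ennpowr_mono test Q) auto
    also have "ennreal ((CD * ?V Q powr (- 1 / p0)) powr p) * ennreal (?V Q)
        = ennreal (CD powr p * ?V Q powr (1 - p / p0))"
      unfolding powr_minus_divide_mult[OF V, symmetric] powr_mult
      by (simp add: mult.assoc flip: ennreal_mult)
    finally show ?thesis by (simp add: ennpowr_mult)
  qed
  show ?thesis
  proof (intro bexI[of _ H] conjI ballI)
    fix x assume "x \<in> Q"
    then have "ennpowr (sparse_op K \<S> m f x) p \<le> ennpowr (U x + L) p"
      using point p by (intro ennpowr_mono) auto
    also have "\<dots> \<le> ennreal (2 powr p) * (ennpowr (U x) p + ennpowr L p)"
      using p by (intro ennpowr_add_le) simp
    finally show "ennpowr (sparse_op K \<S> m f x) p * ennreal (\<mu> x) \<le> H x"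
      unfolding H_def by (rule mult_right_mono) simp
  next
    have "(\<integral>\<^sup>+x\<in>Q. H x \<partial>lebesgue) = (\<integral>\<^sup>+x. ennreal (2 powr p) *
        (ennpowr (U x) p * ennreal (\<mu> x) * indicator Q x + ennpowr L p * ennreal (\<mu> x) * indicator Q x) \<partial>lebesgue)"
      by (simp add: H_def algebra_simps)
    also have "\<dots> = ennreal (2 powr p) * ((\<integral>\<^sup>+x\<in>Q. ennpowr (U x) p * ennreal (\<mu> x) \<partial>lebesgue)
        + (\<integral>\<^sup>+x\<in>Q. ennpowr L p * ennreal (\<mu> x) \<partial>lebesgue))"
      by (subst nn_integral_cmult) (auto simp: nn_integral_add)
    also have "\<dots> \<le> ennreal (2 powr p) * (ennreal (C1 * ?V Q powr (1 - p / p0)) * ennpowr (ennreal \<alpha> * B) p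
        + ennreal (CD powr p * ?V Q powr (1 - p / p0)) * ennpowr (ennreal \<alpha> * B) p)"
      by (intro mult_left_mono add_mono HU HL) auto
    also have "\<dots> = ennreal (2 powr p * (C1 + CD powr p) * ?V Q powr (1 - p / p0)) * ennpowr (ennreal \<alpha> * B) p"
      using C1 by (simp only: distrib_right[symmetric] mult.assoc[symmetric] ennreal_plus[symmetric]
          ennreal_mult[symmetric] mult_nonneg_nonneg powr_ge_zero add_nonneg_nonneg)
    finally show "(\<integral>\<^sup>+x\<in>Q. H x \<partial>lebesgue) \<le> ennreal (2 powr p * (C1 + CD powr p) * ?V Q powr (1 - p / p0)) *
      ennpowr (ennreal \<alpha> * prod_morrey_norm m P p0 f) p"
      unfolding B_def .
  qed (simp add: H_def)
qed

text \<open>The majorants on the 2^n dyadic cubes covering R are added; \<open>CARD(bool^'n)\<close>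
  is the number of these cubes. The common factor comes out of the p-th root as
  \<open>Z\<close>.\<close>

lemma sparse_op_bound:
  fixes \<mu> :: "real^'n::finite \<Rightarrow> real" and p p0 :: real
  assumes mu: "weight \<mu>" and p: "1 < p" "p \<le> p0" and C: "0 < C"
    and H: "\<And>Q. Q \<in> dyadic_grid \<Longrightarrow> \<exists>H\<in>borel_measurable lebesgue.
      (\<forall>x\<in>Q. ennpowr (g x) p * ennreal (\<mu> x) \<le> H x) \<and>
      (\<integral>\<^sup>+x\<in>Q. H x \<partial>lebesgue) \<le> ennreal (C * measure lebesgue Q powr (1 - p / p0)) * ennpowr Z p"
  shows "radon_morrey_norm \<mu> p p0 g
    \<le> ennreal ((real CARD(bool^'n) * C * (2 ^ CARD('n)) powr (1 - p / p0)) powr (1 / p)) * Z"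
  unfolding radon_morrey_norm_def
proof (rule SUP_least)
  fix R :: "(real^'n) set" assume R: "R \<in> cubes"
  let ?V = "measure lebesgue" and ?d = "2 ^ CARD('n) :: real"
  have V: "0 < ?V R" using cubes_facts(3)[OF R] .
  \<comment> \<open>The point where p \<le> p0 enters: the dyadic bound is monotone in the volume,
    so each covering cube may be replaced by one of volume 2^n * |R|.\<close>
  have pp: "0 \<le> 1 - p / p0" using p by simp
  obtain q :: "bool^'n \<Rightarrow> (real^'n) set" where q: "\<And>v. q v \<in> dyadic_grid" "R \<subseteq> (\<Union>v. q v)"
      "\<And>v. ?V (q v) \<le> ?d * ?V R"
    by (rule cube_dyadic_cover[OF R], rule that)
  have "\<forall>v. \<exists>H. H \<in> borel_measurable lebesgue \<and>
      (\<forall>x\<in>q v. ennpowr (g x) p * ennreal (\<mu> x) \<le> H x) \<and>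
      (\<integral>\<^sup>+x\<in>q v. H x \<partial>lebesgue) \<le> ennreal (C * ?V (q v) powr (1 - p / p0)) * ennpowr Z p"
    using H[OF q(1)] unfolding Bex_def by simp
  from choice[OF this] obtain h where h: "\<And>v. h v \<in> borel_measurable lebesgue"
      "\<And>v x. x \<in> q v \<Longrightarrow> ennpowr (g x) p * ennreal (\<mu> x) \<le> h v x"
      "\<And>v. (\<integral>\<^sup>+x\<in>q v. h v x \<partial>lebesgue) \<le> ennreal (C * ?V (q v) powr (1 - p / p0)) * ennpowr Z p"
    by auto
  note [measurable] = h(1) sets_dyadic[OF q(1)]
  define c where "c = C * (?d * ?V R) powr (1 - p / p0)"
  have c: "0 \<le> c" using C by (simp add: c_def)
  have "(\<integral>\<^sup>+x\<in>R. ennpowr (g x) p * ennreal (\<mu> x) \<partial>lebesgue)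
      \<le> (\<integral>\<^sup>+x. (\<Sum>v\<in>UNIV. h v x * indicator (q v) x) \<partial>lebesgue)"
  proof (rule nn_integral_mono)
    fix x
    show "ennpowr (g x) p * ennreal (\<mu> x) * indicator R x \<le> (\<Sum>v\<in>UNIV. h v x * indicator (q v) x)"
    proof (cases "x \<in> R")
      case True
      then obtain v where v: "x \<in> q v" using q(2) by auto
      have "ennpowr (g x) p * ennreal (\<mu> x) * indicator R x \<le> h v x * indicator (q v) x"
        using h(2)[OF v] v True by simp
      also have "\<dots> \<le> (\<Sum>v\<in>UNIV. h v x * indicator (q v) x)"
        by (rule member_le_sum) auto
      finally show ?thesis .
    qed simp
  qed
  also have "\<dots> = (\<Sum>v\<in>UNIV. \<integral>\<^sup>+x\<in>q v. h v x \<partial>lebesgue)"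
    by (intro nn_integral_sum) auto
  also have "\<dots> \<le> (\<Sum>v\<in>(UNIV :: (bool^'n) set). ennreal c * ennpowr Z p)"
  proof (rule sum_mono)
    fix v
    have "C * ?V (q v) powr (1 - p / p0) \<le> c"
      unfolding c_def using C pp q(3)[of v] by (intro mult_left_mono powr_mono2) auto
    then have "ennreal (C * ?V (q v) powr (1 - p / p0)) * ennpowr Z p \<le> ennreal c * ennpowr Z p"
      by (intro mult_right_mono ennreal_leI) auto
    with h(3)[of v] show "(\<integral>\<^sup>+x\<in>q v. h v x \<partial>lebesgue) \<le> ennreal c * ennpowr Z p"
      by (rule order_trans)
  qed
  also have "\<dots> = ennreal (real CARD(bool^'n) * c) * ennpowr Z p"
    using c by (simp add: ennreal_mult ennreal_of_nat_eq_real_of_nat mult.assoc)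
  finally have "ennpowr (\<integral>\<^sup>+x\<in>R. ennpowr (g x) p * ennreal (\<mu> x) \<partial>lebesgue) (1 / p)
      \<le> ennpowr (ennreal (real CARD(bool^'n) * c) * ennpowr Z p) (1 / p)"
    using p by (intro ennpowr_mono) auto
  also have "\<dots> = ennreal ((real CARD(bool^'n) * c) powr (1 / p)) * Z"
    using p c by (simp add: ennpowr_mult ennpowr_ennpowr)
  also have "(real CARD(bool^'n) * c) powr (1 / p)
      = (real CARD(bool^'n) * C * ?d powr (1 - p / p0)) powr (1 / p) * ?V R powr (1 / p - 1 / p0)"
  proof -
    \<comment> \<open>The remaining power of |R| is the reciprocal of the weight in the Morrey norm
      and will cancel against it.\<close>
    have e: "(1 - p / p0) * (1 / p) = 1 / p - 1 / p0"
      using p by (simp add: field_simps)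
    have "real CARD(bool^'n) * c = (real CARD(bool^'n) * C * ?d powr (1 - p / p0)) * ?V R powr (1 - p / p0)"
      using V by (simp add: c_def powr_mult)
    then have "(real CARD(bool^'n) * c) powr (1 / p)
        = (real CARD(bool^'n) * C * ?d powr (1 - p / p0)) powr (1 / p) * (?V R powr (1 - p / p0)) powr (1 / p)"
      using C by (simp only: powr_mult)
    then show ?thesis by (simp only: powr_powr e)
  qed
  finally have "ennpowr (\<integral>\<^sup>+x\<in>R. ennpowr (g x) p * ennreal (\<mu> x) \<partial>lebesgue) (1 / p)
      \<le> ennreal ((real CARD(bool^'n) * C * ?d powr (1 - p / p0)) powr (1 / p) * ?V R powr (1 / p - 1 / p0)) * Z" .
  then have "ennreal (?V R powr (1 / p0 - 1 / p)) * ennpowr (\<integral>\<^sup>+x\<in>R. ennpowr (g x) p * ennreal (\<mu> x) \<partial>lebesgue) (1 / p)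
      \<le> ennreal (?V R powr (1 / p0 - 1 / p)) *
        (ennreal ((real CARD(bool^'n) * C * ?d powr (1 - p / p0)) powr (1 / p) * ?V R powr (1 / p - 1 / p0)) * Z)"
    by (rule mult_left_mono) simp
  also have "\<dots> = ennreal (?V R powr (1 / p0 - 1 / p) *
      ((real CARD(bool^'n) * C * ?d powr (1 - p / p0)) powr (1 / p) * ?V R powr (1 / p - 1 / p0))) * Z"
    by (simp only: mult.assoc[symmetric] ennreal_mult[symmetric] powr_ge_zero mult_nonneg_nonneg)
  also have "?V R powr (1 / p0 - 1 / p) *
      ((real CARD(bool^'n) * C * ?d powr (1 - p / p0)) powr (1 / p) * ?V R powr (1 / p - 1 / p0))
      = (real CARD(bool^'n) * C * ?d powr (1 - p / p0)) powr (1 / p)"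
  proof -
    have "?V R powr (1 / p0 - 1 / p) * ?V R powr (1 / p - 1 / p0) = 1"
      using V by (simp flip: powr_add)
    then show ?thesis by (subst mult.left_commute) (simp only: mult_1_right)
  qed
  finally show "ennreal (?V R powr (1 / p0 - 1 / p)) *
      ennpowr (\<integral>\<^sup>+x\<in>R. ennpowr (g x) p * ennreal (\<mu> x) \<partial>lebesgue) (1 / p)
    \<le> ennreal ((real CARD(bool^'n) * C * ?d powr (1 - p / p0)) powr (1 / p)) * Z" .
qed

section \<open>The two hypotheses on \<mu> and the choice of the constant\<close>

theorem theorem2p1:
  fixes m :: nat and \<mu> :: "real^'n::finite \<Rightarrow> real"
    and K :: "(real^'n) set \<Rightarrow> real" and \<S> :: "(real^'n) set set"
    and P :: "nat \<Rightarrow> real" and p p0 :: real and A0 :: ennreal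
  assumes "weight \<mu>"
    and "\<forall>Q\<in>dyadic_grid. 0 \<le> K Q"
    and "sparse \<S>"
    and "\<forall>i<m. 1 < P i"
    and "1 / p = (\<Sum>i<m. 1 / P i)"
    and "1 < p" and "p \<le> p0"
    and "\<exists>CD. \<forall>Q\<in>dyadic_grid.
           (\<Sum>\<^sub>\<infinity>Q'\<in>{Q'\<in>dyadic_grid. Q \<subset> Q'}.
               ennreal (K Q' * measure lebesgue Q' powr (real m - 1/p0)))
           \<le> ennreal (CD * K Q * measure lebesgue Q powr (real m - 1/p0))"
    and "(A_infty \<mu> \<and>
           A0 = (SUP Q\<in>dyadic_grid. ennreal (K Q * measure lebesgue Q ^ m) *
                  ennpowr ((\<integral>\<^sup>+x\<in>Q. ennreal (\<mu> x) \<partial>lebesgue) / ennreal (measure lebesgue Q)) (1/p))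
           \<and> A0 < \<infinity>)
       \<or> (\<exists>r>1.
           A0 = (SUP Q\<in>dyadic_grid. ennreal (K Q * measure lebesgue Q ^ m) *
                  ennpowr ((\<integral>\<^sup>+x\<in>Q. ennreal (\<mu> x powr r) \<partial>lebesgue) / ennreal (measure lebesgue Q))
                    (1/(r*p)))
           \<and> A0 < \<infinity>)"
  shows "\<exists>C>0. \<forall>f :: nat \<Rightarrow> real^'n \<Rightarrow> real.
           (\<forall>i<m. (\<forall>x. 0 \<le> f i x) \<and> locally_integrable (f i)) \<longrightarrow>
           radon_morrey_norm \<mu> p p0 (sparse_op K \<S> m f)
             \<le> ennreal C * A0 * prod_morrey_norm m P p0 f"
proof -
  note mu = assms(1) and S = assms(3) and p = assms(6,7) and pP = assms(5)
  have K: "0 \<le> K Q" if "Q \<in> dyadic_grid" for Q using assms(2) that by blast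
  have P: "1 < P i" if "i < m" for i using assms(4) that by blast
  have SD: "\<S> \<subseteq> dyadic_grid" using S by (simp add: sparse_def)
  obtain E where E: "sparse_on E \<S>" using sparse_imp_sparse_on[OF S] ..
  obtain \<alpha> where \<alpha>: "A0 = ennreal \<alpha>" "0 \<le> \<alpha>"
  proof -
    have "A0 < \<infinity>" using assms(9) by blast
    then show thesis using that by (cases A0) auto
  qed
  obtain CD0 where CD0: "\<And>Q. Q \<in> dyadic_grid \<Longrightarrow>
      (\<Sum>\<^sub>\<infinity>Q'\<in>{Q'\<in>dyadic_grid. Q \<subset> Q'}. ennreal (K Q' * measure lebesgue Q' powr (real m - 1/p0)))
      \<le> ennreal (CD0 * K Q * measure lebesgue Q powr (real m - 1/p0))"
    using assms(8) by blast
  \<comment> \<open>The given constant may be negative; as K is nonnegative, enlarging it preserves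
    the summation bound.\<close>
  define CD where "CD = max CD0 0"
  have CD: "(\<Sum>\<^sub>\<infinity>Q'\<in>{Q'\<in>dyadic_grid. Q \<subset> Q'}. ennreal (K Q' * measure lebesgue Q' powr (real m - 1/p0)))
      \<le> ennreal (CD * K Q * measure lebesgue Q powr (real m - 1/p0))" if "Q \<in> dyadic_grid" for Q
  proof -
    have "CD0 * K Q * measure lebesgue Q powr (real m - 1/p0) \<le> CD * K Q * measure lebesgue Q powr (real m - 1/p0)"
      using K[OF that] by (intro mult_right_mono) (auto simp: CD_def)
    then show ?thesis by (rule order_trans[OF CD0[OF that] ennreal_leI])
  qed
  have CD_nonneg: "0 \<le> CD" by (simp add: CD_def)
  have st: "sparse_testing m \<mu> K P p F E Q f \<alpha>"
    if "finite F" "F \<subseteq> \<S>" "\<And>S. S \<in> F \<Longrightarrow> S \<subseteq> Q" "Q \<in> dyadic_grid"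
      "\<And>i. i < m \<Longrightarrow> f i \<in> borel_measurable lebesgue" "\<And>i x. i < m \<Longrightarrow> 0 \<le> f i x" for F Q f
    by unfold_locales (fact mu K P p(1) pP \<alpha>(2) that sparse_on_subset[OF E that(2)])+
  define D0 where "D0 = (\<Sum>i<m. 2 * Carleson_const (P i))"
  have D0: "0 \<le> D0"
    unfolding D0_def using Carleson_const_pos[OF P] by (intro sum_nonneg) (auto simp: less_imp_le)
  let ?test = "\<lambda>Q. ennreal (K Q * measure lebesgue Q ^ m) *
      ennpowr ((\<integral>\<^sup>+x\<in>Q. ennreal (\<mu> x) \<partial>lebesgue) / ennreal (measure lebesgue Q)) (1/p)"
  let ?bump = "\<lambda>r Q. ennreal (K Q * measure lebesgue Q ^ m) *
      ennpowr ((\<integral>\<^sup>+x\<in>Q. ennreal (\<mu> x powr r) \<partial>lebesgue) / ennreal (measure lebesgue Q)) (1/(r*p))"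
  let ?small = "\<lambda>C1 F Q f. (\<integral>\<^sup>+x. ennreal (sparse_sum K F m f x powr p) \<partial>density lebesgue (\<lambda>x. ennreal (\<mu> x)))
      \<le> ennreal (C1 * \<alpha> powr p) *
        (\<Prod>i<m. ennpowr (\<integral>\<^sup>+x\<in>Q. ennreal (f i x powr P i) \<partial>lebesgue) (p / P i))"
  \<comment> \<open>The quantifier order matters: one constant for all finite subfamilies, cubes and
    f, which is why C does not depend on f.\<close>
  have "\<exists>C1\<ge>0. (\<forall>F Q f. sparse_testing m \<mu> K P p F E Q f \<alpha> \<longrightarrow> F \<subseteq> \<S> \<longrightarrow> ?small C1 F Q f) \<and>
      (\<forall>Q\<in>dyadic_grid. ?test Q \<le> ennreal \<alpha>)"
    using assms(9)
  proof (elim disjE exE conjE)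
    assume A: "A_infty \<mu>" "A0 = (SUP Q\<in>dyadic_grid. ?test Q)"
    obtain c where c: "0 \<le> c" "\<And>Q E. Q \<in> dyadic_grid \<Longrightarrow> E \<subseteq> Q \<Longrightarrow> E \<in> sets lebesgue \<Longrightarrow>
        measure lebesgue Q \<le> 2 * measure lebesgue E \<Longrightarrow>
        (\<integral>\<^sup>+x\<in>Q. ennreal (\<mu> x) \<partial>lebesgue) \<le> ennreal c * (\<integral>\<^sup>+x\<in>E. ennreal (\<mu> x) \<partial>lebesgue)"
      by (rule A_infty_doubling[OF mu A(1)], rule that)
    have test: "?test Q \<le> ennreal \<alpha>" if "Q \<in> dyadic_grid" for Q
      unfolding \<alpha>(1)[symmetric] A(2) using that by (rule SUP_upper)
    let ?C = "2 * (2 * ((c + 1) * Carleson_const (p / (p - 1)))) powr (p - 1) * D0"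
    have "?small ?C F Q f" if ss: "sparse_testing m \<mu> K P p F E Q f \<alpha>" and F: "F \<subseteq> \<S>" for F Q f
    proof -
      interpret sparse_testing m \<mu> K P p F E Q f \<alpha> by (rule ss)
      have "(\<integral>\<^sup>+x\<in>S. ennreal (\<mu> x) \<partial>lebesgue) \<le> ennreal (c + 1) * (\<integral>\<^sup>+x\<in>E S. ennreal (\<mu> x) \<partial>lebesgue)"
        if "S \<in> F" for S
      proof -
        have "(\<integral>\<^sup>+x\<in>S. ennreal (\<mu> x) \<partial>lebesgue) \<le> ennreal c * (\<integral>\<^sup>+x\<in>E S. ennreal (\<mu> x) \<partial>lebesgue)"
          using E F that by (intro c(2)) (auto simp: sparse_on_def)
        \<comment> \<open>The doubling constant may be 0, while the absorption argument wants a
          positive one.\<close>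
        also have "\<dots> \<le> ennreal (c + 1) * (\<integral>\<^sup>+x\<in>E S. ennreal (\<mu> x) \<partial>lebesgue)"
          by (intro mult_right_mono ennreal_leI) auto
        finally show ?thesis .
      qed
      with c(1) show ?thesis
        unfolding D0_def D_def[symmetric] N_def[symmetric]
        by (intro small_part_A_infty test F_dyadic) simp_all
    qed
    moreover have "0 \<le> ?C"
      using D0 by simp
    ultimately show ?thesis
      using test by (intro exI[of _ ?C] conjI allI impI ballI)
  next
    fix r :: real
    assume r: "1 < r" and A: "A0 = (SUP Q\<in>dyadic_grid. ?bump r Q)"
    have bump: "?bump r Q \<le> ennreal \<alpha>" if "Q \<in> dyadic_grid" for Q
      unfolding \<alpha>(1)[symmetric] A using that by (rule SUP_upper)
    \<comment> \<open>The cubes above \<open>Q\<close> need the plain testing bound in this case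
      too; Jensen's inequality with exponent r gives it with the same constant.\<close>
    have "?test Q \<le> ?bump r Q" if Q: "Q \<in> dyadic_grid" for Q
    proof (rule mult_left_mono)
      let ?V = "measure lebesgue Q" and ?I = "\<integral>\<^sup>+x\<in>Q. ennreal (\<mu> x powr r) \<partial>lebesgue"
      have V: "0 < ?V" by (rule measure_dyadic_pos[OF Q])
      have "(\<integral>\<^sup>+x\<in>Q. ennreal (\<mu> x) \<partial>lebesgue) \<le> ennreal ?V * ennpowr (?I / ennreal ?V) (1 / r)"
        using mu by (intro Jensen_dyadic Q r) (auto simp: weight_def locally_integrable_def)
      then have "(\<integral>\<^sup>+x\<in>Q. ennreal (\<mu> x) \<partial>lebesgue) / ennreal ?V \<le> ennpowr (?I / ennreal ?V) (1 / r)"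
        using V by (subst divide_le_posI_ennreal) (auto simp: mult.commute)
      then have "ennpowr ((\<integral>\<^sup>+x\<in>Q. ennreal (\<mu> x) \<partial>lebesgue) / ennreal ?V) (1 / p)
          \<le> ennpowr (ennpowr (?I / ennreal ?V) (1 / r)) (1 / p)"
        using p by (intro ennpowr_mono) auto
      then show "ennpowr ((\<integral>\<^sup>+x\<in>Q. ennreal (\<mu> x) \<partial>lebesgue) / ennreal ?V) (1 / p)
          \<le> ennpowr (?I / ennreal ?V) (1 / (r * p))"
        by (simp add: ennpowr_ennpowr)
    qed simp
    then have test: "?test Q \<le> ennreal \<alpha>" if "Q \<in> dyadic_grid" for Q
      using bump[OF that] that by (meson order_trans)
    let ?C = "2 * (2 * (2 * Carleson_const ((r * p - 1) / (r * (p - 1))))) powr (p - 1) * D0"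
    have "?small ?C F Q f" if ss: "sparse_testing m \<mu> K P p F E Q f \<alpha>" for F Q f
    proof -
      interpret sparse_testing m \<mu> K P p F E Q f \<alpha> by (rule ss)
      show ?thesis
        unfolding D0_def D_def[symmetric] N_def[symmetric]
        by (intro small_part_power_bump r bump F_dyadic)
    qed
    moreover have "0 \<le> ?C"
      using D0 by simp
    ultimately show ?thesis
      using test by (intro exI[of _ ?C] conjI allI impI ballI)
  qed
  then obtain C1 where C1: "0 \<le> C1"
      and small: "\<And>F Q f. sparse_testing m \<mu> K P p F E Q f \<alpha> \<Longrightarrow> F \<subseteq> \<S> \<Longrightarrow> ?small C1 F Q f"
      and test: "\<And>Q. Q \<in> dyadic_grid \<Longrightarrow> ?test Q \<le> ennreal \<alpha>"
    by (elim exE conjE) (rule that, assumption, simp_all only:)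
  \<comment> \<open>Adding 1 keeps the final constant positive even if C1 and CD are both 0.\<close>
  define C2 where "C2 = 2 powr p * ((C1 + 1) + CD powr p)"
  have C2: "0 < C2" using C1 by (simp add: C2_def add_pos_nonneg)
  define C where "C = (real CARD(bool^'n) * C2 * (2 ^ CARD('n)) powr (1 - p / p0)) powr (1 / p)"
  show ?thesis
  proof (intro exI[of _ C] conjI allI impI)
    show "0 < C" using C2 by (simp add: C_def)
    fix f :: "nat \<Rightarrow> real^'n \<Rightarrow> real"
    assume "\<forall>i<m. (\<forall>x. 0 \<le> f i x) \<and> locally_integrable (f i)"
    then have f: "locally_integrable (f i)" "0 \<le> f i x" "f i \<in> borel_measurable lebesgue" if "i < m" for i x
      using that by (auto simp: locally_integrable_def)
    have "radon_morrey_norm \<mu> p p0 (sparse_op K \<S> m f)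
        \<le> ennreal C * (ennreal \<alpha> * prod_morrey_norm m P p0 f)"
      unfolding C_def
    proof (rule sparse_op_bound[OF mu p C2])
      fix Q :: "(real^'n) set" assume Q: "Q \<in> dyadic_grid"
      have small': "?small (C1 + 1) F Q f" if "finite F" "F \<subseteq> \<S>" "\<And>S. S \<in> F \<Longrightarrow> S \<subseteq> Q" for F
      proof -
        have "?small C1 F Q f"
          using that Q f by (intro small st) auto
        also have "ennreal (C1 * \<alpha> powr p) \<le> ennreal ((C1 + 1) * \<alpha> powr p)"
          by (intro ennreal_leI mult_right_mono) auto
        finally show ?thesis by (simp add: mult_right_mono)
      qed
      show "\<exists>H\<in>borel_measurable lebesgue.
          (\<forall>x\<in>Q. ennpowr (sparse_op K \<S> m f x) p * ennreal (\<mu> x) \<le> H x) \<and>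
          (\<integral>\<^sup>+x\<in>Q. H x \<partial>lebesgue) \<le> ennreal (C2 * measure lebesgue Q powr (1 - p / p0)) *
            ennpowr (ennreal \<alpha> * prod_morrey_norm m P p0 f) p"
        unfolding C2_def using C1
        by (intro sparse_op_dyadic_bound[OF mu K SD P pP p(1) CD_nonneg CD \<alpha>(2) test f(1,2) Q _ small']) auto
    qed
    then show "radon_morrey_norm \<mu> p p0 (sparse_op K \<S> m f) \<le> ennreal C * A0 * prod_morrey_norm m P p0 f"
      by (simp add: \<alpha>(1) mult.assoc)
  qed
qed

end
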